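(* Let $m\in\mathbb{Z}\setminus\{0\}$, let $f_m(X)=X^3+mX+m\in\mathbb{Z}[X]$, and let \[F_m(X,Y)=X^3-2mX^2Y-9mXY^2-m(2m+27)Y^3\in\mathbb{Z}[X,Y].\] If there exists $n\in\mathbb{Z}\setminus\{0\}$ with $n\neq m$ such that the splitting fields of $f_n(X)$ and of $f_m(X)$ over $\mathbb{Q}$ coincide, then there exist $\lambda\in\mathbb{Z}$ such that $\lambda^2$ divides $m^3(4m+27)^5$ and a pair $(x,y)\in\mathbb{Z}^2$ with $\gcd(x,y)=1$ and $y>0$ satisfying \[F_m(x,y)=x^3-2mx^2y-9mxy^2-m(2m+27)y^3=\lambda; \qquad ( * )\] in particular, such a primitive solution $(x,y)$ can be chosen to satisfy \[ n=m+\frac{m(4m+27)\,y\,(x^2+9xy+27y^2+my^2)(x^3-mx^2y-m^2y^3)}{F_m(x,y)^2}. \qquad ( ** )\] Conversely, if $(x,y)\in\mathbb{Z}^2$ with $\gcd(x,y)=1$ is a solution to $( * )$ for some $\lambda\in\mathbb{Z}$ such that $\lambda^2$ divides $m^3(4m+27)^5$, then for the rational number $n\in\mathbb{Q}$ determined by $( ** )$, the splitting fields of $f_n(X)=X^3+nX+n$ and of $f_m(X)$ over $\mathbb{Q}$ coincide, except in the cases $n=0$ and $n=-27/4$. Furthermore, for a fixed $m\in\mathbb{Z}\setminus\{0\}$ there exist only finitely many $n\in\mathbb{Z}$ such that the splitting fields of $f_m(X)$ and of $f_n(X)$ over $\mathbb{Q}$ coincide.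
   Context: A solution $(x,y)\in\mathbb{Z}^2$ is called primitive if $\gcd(x,y)=1$. For a rational number $a$, $f_a(X)=X^3+aX+a$. *)

theory Defs
  imports Complex_Main "HOL-Computational_Algebra.Polynomial" "HOL-Algebra.Generated_Fields"
    "HOL-Algebra.Algebraic_Closure_Type"
begin

text \<open>Splitting fields over the rationals are taken inside the fixed algebraically closed field
  of complex numbers, so that two of them coincide iff they are equal as sets.\<close>

definition splitting_field :: "rat poly \<Rightarrow> complex set" where
  "splitting_field p =
     generate_field ring_of_type_algebra (\<rat> \<union> {z. poly (map_poly of_rat p) z = 0})"

definition f_poly :: "rat \<Rightarrow> rat poly" where
  "f_poly a = [:a, a, 0, 1:]"

definition F_form :: "int \<Rightarrow> int \<Rightarrow> int \<Rightarrow> int" where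
  "F_form m x y = x^3 - 2*m*x^2*y - 9*m*x*y^2 - m*(2*m + 27)*y^3"

definition n_param :: "int \<Rightarrow> int \<Rightarrow> int \<Rightarrow> rat" where
  "n_param m x y =
     of_int m
     + of_int (m*(4*m + 27)*y*(x^2 + 9*x*y + 27*y^2 + m*y^2)*(x^3 - m*x^2*y - m^2*y^3))
       / of_int ((F_form m x y)^2)"

end

theory Submission
  imports Defs
begin

text \<open>
  Let \<open>\<theta>\<close> be a root of \<open>f_m\<close>. Up to scaling, the trace zero elements of \<open>\<rat>(\<theta>)\<close> are
  \<open>\<beta> = 2my + x\<theta> + 3y\<theta>\<^sup>2\<close>, and \<open>\<beta>\<^sup>3 + mP\<beta> + mF = 0\<close> with \<open>F = F_m(x, y)\<close> and
  \<open>P = x\<^sup>2 + 9xy - 3my\<^sup>2\<close>. Hence \<open>\<beta>P/F\<close> is a root of \<open>f_n\<close> for \<open>n = mP\<^sup>3/F\<^sup>2\<close>, which is the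
  parametrisation in the theorem, and \<open>\<theta>\<close> can be recovered from \<open>\<beta>\<close> unless \<open>4n + 27 = 0\<close>.

  Conversely, if the splitting fields agree, some root of \<open>f_n\<close> lies in \<open>\<rat>(\<theta>)\<close>, because the
  splitting field is at most quadratic over \<open>\<rat>(\<theta>)\<close>; being of trace zero it has the above shape,
  so \<open>n = mP\<^sup>3/F\<^sup>2\<close> for coprime \<open>x, y\<close>. If \<open>n\<close> is an integer, then \<open>F\<^sup>2\<close> divides \<open>mP\<^sup>3\<close>, and
  elimination of \<open>x\<close> and \<open>y\<close> gives \<open>F\<^sup>2 dvd m\<^sup>3(4m + 27)\<^sup>5\<close>. The only integers \<open>m\<close> for which
  \<open>f_m\<close> is reducible are \<open>0\<close> and \<open>-8\<close>.

  Finiteness follows from Thue's theorem for the irreducible cubic form \<open>F_m\<close>. For a cubic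
  irrationality \<open>\<alpha>\<close>, the pigeonhole principle yields integer polynomials \<open>A, B\<close> of small height such
  that \<open>A - \<alpha>B\<close> vanishes to high order at \<open>\<alpha>\<close>. If \<open>p\<^sub>0/q\<^sub>0\<close> and \<open>p\<^sub>1/q\<^sub>1\<close> approximate \<open>\<alpha>\<close> with
  error \<open>O(q\<^sup>-\<^sup>3)\<close>, some low derivative of \<open>A - (p\<^sub>1/q\<^sub>1)B\<close> at \<open>p\<^sub>0/q\<^sub>0\<close> is nonzero by a Wronskian
  argument, yet is too small for its denominator if \<open>q\<^sub>0\<close> is large and \<open>q\<^sub>1\<close> much larger.
\<close>

section \<open>Subfields of the complex numbers and splitting fields\<close>

text \<open>Closure under \<open>inverse\<close> is asked of every element, which costs nothing
  because \<open>inverse 0 = 0\<close>. This concrete form replaces the record-based notion of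
  subfield in all later arguments.\<close>

definition subfield_complex :: "complex set \<Rightarrow> bool" where
  "subfield_complex S \<longleftrightarrow> \<rat> \<subseteq> S \<and> (\<forall>x\<in>S. \<forall>y\<in>S. x + y \<in> S \<and> x * y \<in> S) \<and>
     (\<forall>x\<in>S. - x \<in> S \<and> inverse x \<in> S)"

lemma subfield_complexD:
  assumes "subfield_complex S"
  shows "x \<in> \<rat> \<Longrightarrow> x \<in> S" "x \<in> S \<Longrightarrow> y \<in> S \<Longrightarrow> x + y \<in> S"
    "x \<in> S \<Longrightarrow> y \<in> S \<Longrightarrow> x * y \<in> S" "x \<in> S \<Longrightarrow> - x \<in> S" "x \<in> S \<Longrightarrow> inverse x \<in> S"
    "x \<in> S \<Longrightarrow> y \<in> S \<Longrightarrow> x - y \<in> S" "x \<in> S \<Longrightarrow> y \<in> S \<Longrightarrow> x / y \<in> S"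
    "x \<in> S \<Longrightarrow> x ^ k \<in> S"
proof -
  note S = assms[unfolded subfield_complex_def]
  show "x \<in> \<rat> \<Longrightarrow> x \<in> S" "x \<in> S \<Longrightarrow> y \<in> S \<Longrightarrow> x + y \<in> S"
    "x \<in> S \<Longrightarrow> y \<in> S \<Longrightarrow> x * y \<in> S" "x \<in> S \<Longrightarrow> - x \<in> S" "x \<in> S \<Longrightarrow> inverse x \<in> S"
    using S by auto
  show "x \<in> S \<Longrightarrow> y \<in> S \<Longrightarrow> x - y \<in> S"
    using S by (metis add_uminus_conv_diff)
  show "x \<in> S \<Longrightarrow> y \<in> S \<Longrightarrow> x / y \<in> S"
    using S by (metis divide_inverse)
  have 1: "1 \<in> S" using S by (metis Rats_1 subsetD)
  show "x ^ k \<in> S" if "x \<in> S" by (induction k) (use S 1 that in auto)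
qed

lemma subfield_complex_Rats: "subfield_complex \<rat>"
  by (auto simp: subfield_complex_def)

lemma ring_of_type_algebra_simps:
  fixes x y :: complex
  shows "x \<oplus>\<^bsub>ring_of_type_algebra\<^esub> y = x + y" "x \<otimes>\<^bsub>ring_of_type_algebra\<^esub> y = x * y"
    "\<one>\<^bsub>ring_of_type_algebra\<^esub> = (1 :: complex)" "\<zero>\<^bsub>ring_of_type_algebra\<^esub> = (0 :: complex)"
    "\<ominus>\<^bsub>ring_of_type_algebra\<^esub> x = - x" "x \<noteq> 0 \<Longrightarrow> inv\<^bsub>ring_of_type_algebra\<^esub> x = inverse x"
proof -
  interpret R: field "ring_of_type_algebra :: complex ring"
    by (rule field_from_type_algebra)
  have c: "carrier (ring_of_type_algebra :: complex ring) = UNIV"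
    by (simp add: ring_of_type_algebra_def)
  show a: "x \<oplus>\<^bsub>ring_of_type_algebra\<^esub> y = x + y" and m: "x \<otimes>\<^bsub>ring_of_type_algebra\<^esub> y = x * y"
    and o: "\<one>\<^bsub>ring_of_type_algebra\<^esub> = (1 :: complex)"
    and z: "\<zero>\<^bsub>ring_of_type_algebra\<^esub> = (0 :: complex)" for x y :: complex
    by (simp_all add: ring_of_type_algebra_def)
  show "\<ominus>\<^bsub>ring_of_type_algebra\<^esub> x = - x"
    by (rule R.minus_equality) (simp_all add: a z c)
  show "inv\<^bsub>ring_of_type_algebra\<^esub> x = inverse x" if "x \<noteq> 0"
    using that by (intro R.comm_inv_char) (simp_all add: m o c)
qed

lemma subfield_complex_splitting_field: "subfield_complex (splitting_field p)"
proof -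
  note intros = generate_field.intros[where R = "ring_of_type_algebra :: complex ring",
      unfolded ring_of_type_algebra_simps]
  have inv: "inverse x \<in> splitting_field p" if "x \<in> splitting_field p" for x
  proof (cases "x = 0")
    case True
    then show ?thesis using that by simp
  next
    case False
    then show ?thesis
      using generate_field.m_inv[of x ring_of_type_algebra] that
      by (simp add: splitting_field_def ring_of_type_algebra_simps)
  qed
  show ?thesis
    using inv unfolding subfield_complex_def splitting_field_def by (auto intro: intros)
qed

lemma splitting_field_minimal:
  assumes S: "subfield_complex S" and roots: "\<And>z. poly (map_poly of_rat p) z = 0 \<Longrightarrow> z \<in> S"
  shows "splitting_field p \<subseteq> S"
proof
  fix x assume "x \<in> splitting_field p"
  then show "x \<in> S"
    unfolding splitting_field_def
    by (induction rule: generate_field.induct)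
      (auto simp: ring_of_type_algebra_simps roots intro: subfield_complexD[OF S])
qed

lemma root_in_splitting_field: "poly (map_poly of_rat p) z = 0 \<Longrightarrow> z \<in> splitting_field p"
  unfolding splitting_field_def by (intro generate_field.incl) simp

lemma poly_f_poly: "poly (map_poly of_rat (f_poly a)) z = z ^ 3 + of_rat a * z + (of_rat a :: complex)"
  by (simp add: f_poly_def map_poly_pCons algebra_simps power3_eq_cube)

section \<open>Roots of cubics and the field generated by a cubic irrationality\<close>

lemma depressed_cubic_factors:
  fixes a b :: complex
  obtains r s t where "r + s + t = 0" "r*s + s*t + t*r = a" "r*s*t = - b"
    "\<And>z. z ^ 3 + a*z + b = (z - r)*(z - s)*(z - t)"
proof -
  have "\<exists>z. poly [:b, a, 0, 1:] z = 0"
    by (rule fundamental_theorem_of_algebra) (simp add: constant_degree)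
  then obtain r where r: "r ^ 3 + a*r + b = 0"
    by (auto simp: algebra_simps power3_eq_cube)
  \<comment> \<open>Dividing the cubic by \<open>z - r\<close> leaves
    \<open>z^2 + r*z + (r^2 + a)\<close>, whose discriminant is
    \<open>- 3*r^2 - 4*a\<close>.\<close>
  define d where "d = csqrt (- 3*r^2 - 4*a)"
  have d: "d ^ 2 = - 3*r^2 - 4*a" by (simp add: d_def)
  define s t where "s = (- r + d)/2" and "t = (- r - d)/2"
  have st: "s + t = - r" "s * t = r^2 + a"
    using d by (simp_all add: s_def t_def field_simps power2_eq_square)
  show thesis
  proof (rule that[of r s t])
    show "r + s + t = 0" "r*s + s*t + t*r = a" "r*s*t = - b"
      using st r by Groebner_Basis.algebra+
    show "z ^ 3 + a*z + b = (z - r)*(z - s)*(z - t)" for z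
      using st r by Groebner_Basis.algebra
  qed
qed

lemma cubic_root_denominator_eq_1:
  fixes a b n :: int
  assumes "b > 0" "coprime a b" "a^3 + n*a*b^2 + n*b^3 = 0"
  shows "b = 1"
proof -
  have "a^3 = b * (- n*a*b - n*b^2)" using assms(3) by Groebner_Basis.algebra
  then have "b dvd a^3" by (metis dvd_triv_left)
  moreover have "coprime b (a^3)" using assms(2) by (simp add: coprime_commute)
  ultimately have "is_unit b" by (metis coprime_absorb_left)
  then show ?thesis using assms(1) by simp
qed

text \<open>A rational root of the monic polynomial is an integer \<open>a\<close>, and
  \<open>a^3 + n*(a + 1) = 0\<close> forces \<open>a + 1\<close> to be a unit. The units 1 and -1
  give \<open>n = 0\<close> and \<open>n = - 8\<close>.\<close>

lemma f_poly_rational_root: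
  fixes n :: int and r :: rat
  assumes "r^3 + of_int n * r + of_int n = 0"
  shows "n = 0 \<or> n = - 8"
proof -
  obtain a b where ab: "quotient_of r = (a, b)" by force
  have b: "b > 0" "coprime a b" "r = of_int a / of_int b"
    using ab quotient_of_denom_pos quotient_of_coprime quotient_of_div by auto
  have "of_int (a^3 + n*a*b^2 + n*b^3) = (r^3 + of_int n * r + of_int n) * (of_int b)^3"
    unfolding b(3) using b(1) by (simp add: field_simps power2_eq_square power3_eq_cube)
  then have "of_int (a^3 + n*a*b^2 + n*b^3) = (0::rat)" using assms by simp
  then have e: "a^3 + n*a*b^2 + n*b^3 = 0" by (simp only: of_int_eq_0_iff)
  with b have "b = 1" using cubic_root_denominator_eq_1 by blast
  with e have e: "a^3 + n*(a + 1) = 0" by (simp add: algebra_simps)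
  \<comment> \<open>Here \<open>a^3 + 1 = (a + 1)*(a^2 - a + 1)\<close> turns the equation into a
    factorisation of 1.\<close>
  then have "(a + 1) * (a^2 - a + 1 + n) = 1" by Groebner_Basis.algebra
  then have "a + 1 = 1 \<or> a + 1 = - 1"
    by (metis zmult_eq_1_iff)
  then show ?thesis
  proof
    assume "a + 1 = 1" then show ?thesis using e by simp
  next
    assume "a + 1 = - 1" 
    then have "a = - 2" by simp
    then show ?thesis using e by simp
  qed
qed

text \<open>A cubic over the rationals without rational root is irreducible: a quadratic relation
  for \<theta> would divide it and leave a rational linear factor. This independence replaces
  minimal polynomials and field degrees throughout.\<close>

lemma cubic_independent:
  fixes \<theta> :: complex and a b c p q r :: rat
  assumes root: "\<theta>^3 + of_rat a * \<theta>^2 + of_rat b * \<theta> + of_rat c = 0"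
    and noroot: "\<And>t :: rat. t^3 + a * t^2 + b * t + c \<noteq> 0"
    and rel: "of_rat p + of_rat q * \<theta> + of_rat r * \<theta>^2 = 0"
  shows "p = 0 \<and> q = 0 \<and> r = 0"
proof -
  have irr: "\<theta> \<noteq> of_rat t" for t
  proof
    assume "\<theta> = of_rat t"
    then have "of_rat (t^3 + a * t^2 + b * t + c) = (0::complex)"
      using root by (simp add: of_rat_add of_rat_mult of_rat_power)
    then show False using noroot[of t] by simp
  qed
  have lin: "u = 0 \<and> v = 0" if "of_rat u + of_rat v * \<theta> = 0" for u v :: rat
  proof (cases "v = 0")
    case False
    then have "\<theta> = of_rat (- u / v)" using that
      by (simp add: of_rat_divide of_rat_minus field_simps eq_neg_iff_add_eq_0)
    then show ?thesis using irr by blast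
  qed (use that in auto)
  have "r = 0"
  proof (rule ccontr)
    assume r: "r \<noteq> 0"
    define p' q' where "p' = p / r" and "q' = q / r"
    have "of_rat p = of_rat p' * (of_rat r :: complex)" "of_rat q = of_rat q' * (of_rat r :: complex)"
      using r by (simp_all add: p'_def q'_def of_rat_divide)
    then have "of_rat r * (of_rat p' + of_rat q' * \<theta> + \<theta>^2) = 0"
      using rel by (simp add: algebra_simps)
    then have rel': "of_rat p' + of_rat q' * \<theta> + \<theta>^2 = 0" using r by simp
    \<comment> \<open>The left side is the remainder of the cubic modulo the monic quadratic
      relation. The quotient is \<open>\<theta> + (a - q')\<close>, so a vanishing remainder makes
      \<open>q' - a\<close> a rational root.\<close>
    have "of_rat (c - p' * (a - q')) + of_rat (b - p' - q' * (a - q')) * \<theta>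
        = \<theta>^3 + of_rat a * \<theta>^2 + of_rat b * \<theta> + of_rat c
          - (of_rat p' + of_rat q' * \<theta> + \<theta>^2) * (\<theta> + of_rat (a - q'))"
      unfolding of_rat_diff of_rat_mult by (simp add: algebra_simps power2_eq_square power3_eq_cube)
    then have "of_rat (c - p' * (a - q')) + of_rat (b - p' - q' * (a - q')) * \<theta> = 0"
      using root rel' by simp
    then have "c - p' * (a - q') = 0" "b - p' - q' * (a - q') = 0" using lin by blast+
    then have "(q' - a)^3 + a * (q' - a)^2 + b * (q' - a) + c = 0" by Groebner_Basis.algebra
    then show False using noroot by blast
  qed
  then show ?thesis using rel lin by simp
qed

definition cubic_span :: "complex \<Rightarrow> complex set" where
  "cubic_span \<theta> = {of_rat p + of_rat q * \<theta> + of_rat r * \<theta>^2 | p q r. True}"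

text \<open>Products are reduced with the cubic equation. Inverses come in two stages: linear
  elements divide the nonzero rational number \<open>N\<close>, and an element with a quadratic term
  has a nonzero multiple that is linear.\<close>

lemma subfield_complex_cubic_span:
  fixes \<theta> :: complex and a b :: rat
  assumes root: "\<theta>^3 + of_rat a * \<theta> + of_rat b = 0"
    and noroot: "\<And>t :: rat. t^3 + a * t + b \<noteq> 0"
  shows "subfield_complex (cubic_span \<theta>)"
proof -
  have I: "x \<in> cubic_span \<theta>" if "x = of_rat p + of_rat q * \<theta> + of_rat r * \<theta>^2" for x p q r
    using that unfolding cubic_span_def by blast
  have indep: "p = 0 \<and> q = 0 \<and> r = 0"
    if "of_rat p + of_rat q * \<theta> + of_rat r * \<theta>^2 = 0" for p q r
    using cubic_independent[of \<theta> 0 a b p q r] root noroot that by simp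
  have rats: "\<rat> \<subseteq> cubic_span \<theta>"
  proof
    fix x :: complex assume "x \<in> \<rat>"
    then obtain p where "x = of_rat p" by (auto elim: Rats_cases)
    then show "x \<in> cubic_span \<theta>" by (intro I[of _ p 0 0]) simp
  qed
  have add: "x + y \<in> cubic_span \<theta>" if xy: "x \<in> cubic_span \<theta>" "y \<in> cubic_span \<theta>" for x y
  proof -
    obtain p q r where x: "x = of_rat p + of_rat q * \<theta> + of_rat r * \<theta>^2"
      using xy(1) unfolding cubic_span_def by blast
    obtain p' q' r' where y: "y = of_rat p' + of_rat q' * \<theta> + of_rat r' * \<theta>^2"
      using xy(2) unfolding cubic_span_def by blast
    show ?thesis
      by (rule I[of _ "p + p'" "q + q'" "r + r'"]) (simp add: x y of_rat_add algebra_simps)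
  qed
  have mult: "x * y \<in> cubic_span \<theta>" if xy: "x \<in> cubic_span \<theta>" "y \<in> cubic_span \<theta>" for x y
  proof -
    obtain p q r where x: "x = of_rat p + of_rat q * \<theta> + of_rat r * \<theta>^2"
      using xy(1) unfolding cubic_span_def by blast
    obtain p' q' r' where y: "y = of_rat p' + of_rat q' * \<theta> + of_rat r' * \<theta>^2"
      using xy(2) unfolding cubic_span_def by blast
    show ?thesis
    proof (rule I)
      show "x * y = of_rat (p*p' - b*(q*r' + r*q'))
        + of_rat (p*q' + q*p' - a*(q*r' + r*q') - b*r*r') * \<theta>
        + of_rat (p*r' + q*q' + r*p' - a*r*r') * \<theta>^2"
        using root unfolding x y of_rat_add of_rat_diff of_rat_mult by Groebner_Basis.algebra
    qed
  qed
  have uminus: "- x \<in> cubic_span \<theta>" if "x \<in> cubic_span \<theta>" for x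
  proof -
    have "- 1 \<in> (\<rat> :: complex set)" by simp
    then have "- 1 \<in> cubic_span \<theta>" using rats by blast
    from mult[OF this that] show ?thesis by simp
  qed
  have inv_lin: "inverse (of_rat p + of_rat q * \<theta>) \<in> cubic_span \<theta>" for p q
  proof (cases "q = 0")
    case True
    then show ?thesis using rats by (auto simp: Rats_inverse)
  next
    case False
    \<comment> \<open>With this \<open>t\<close>, \<open>p + q*\<theta> = q*(\<theta> - t)\<close>,
      and dividing the cubic by \<open>\<theta> - t\<close> leaves the remainder \<open>N\<close>,
      its value at \<open>t\<close>.\<close>
    define t where "t = - p / q"
    define N where "N = t^3 + a*t + b"
    have N: "N \<noteq> 0" unfolding N_def by (rule noroot)
    have p: "of_rat p = - of_rat t * (of_rat q :: complex)"
      using False by (simp add: t_def of_rat_minus of_rat_divide)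
    have "(of_rat p + of_rat q * \<theta>) * (\<theta>^2 + of_rat t * \<theta> + of_rat (t^2 + a)) = - of_rat (q * N)"
      using root unfolding p N_def of_rat_add of_rat_mult of_rat_power by Groebner_Basis.algebra
    then have "(of_rat p + of_rat q * \<theta>) * ((\<theta>^2 + of_rat t * \<theta> + of_rat (t^2 + a)) * of_rat (- 1 / (q * N))) = 1"
      using False N by (simp add: of_rat_minus of_rat_divide field_simps)
    then have e: "inverse (of_rat p + of_rat q * \<theta>)
       = (\<theta>^2 + of_rat t * \<theta> + of_rat (t^2 + a)) * of_rat (- 1 / (q * N))"
      by (rule inverse_unique)
    show ?thesis unfolding e
    proof (rule mult)
      show "\<theta>^2 + of_rat t * \<theta> + of_rat (t^2 + a) \<in> cubic_span \<theta>"
        by (rule I[of _ "t^2 + a" t 1]) simp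
      show "of_rat (- 1 / (q * N)) \<in> cubic_span \<theta>" by (rule subsetD[OF rats Rats_of_rat])
    qed
  qed
  have inv: "inverse x \<in> cubic_span \<theta>" if x0: "x \<in> cubic_span \<theta>" for x
  proof -
    obtain p q r where x: "x = of_rat p + of_rat q * \<theta> + of_rat r * \<theta>^2"
      using x0 unfolding cubic_span_def by blast
    show ?thesis
    proof (cases "r = 0")
      case True
      then show ?thesis using inv_lin x by simp
    next
      case False
      \<comment> \<open>Multiplication by \<open>q - r*\<theta>\<close> cancels the \<theta>-squared
        terms; the \<theta>-cubed term is then reduced by the cubic, leaving the linear element
        \<open>u + v*\<theta>\<close>.\<close>
      define u v where "u = r^2*b + p*q" and "v = r^2*a - r*p + q^2"
      have e: "x * (of_rat q - of_rat r * \<theta>) = of_rat u + of_rat v * \<theta>"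
        using root unfolding x u_def v_def of_rat_add of_rat_diff of_rat_mult of_rat_power by Groebner_Basis.algebra
      have "of_rat q - of_rat r * \<theta> \<noteq> 0"
        using indep[of q "- r" 0] False by (auto simp: of_rat_minus)
      moreover have "x \<noteq> 0" using indep[of p q r] False x by auto
      ultimately have nz: "of_rat u + of_rat v * \<theta> \<noteq> 0" using e by (metis mult_eq_0_iff)
      have "inverse x = (of_rat q - of_rat r * \<theta>) * inverse (of_rat u + of_rat v * \<theta>)"
        using e nz \<open>x \<noteq> 0\<close> by (auto simp: field_simps)
      then show ?thesis
        using mult[OF I[of "of_rat q - of_rat r * \<theta>" q "- r" 0] inv_lin] by (simp add: of_rat_minus)
    qed
  qed
  show ?thesis
    unfolding subfield_complex_def by (intro conjI ballI rats add mult uminus inv)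
qed

text \<open>Inverses are formed with the conjugate \<open>a - b*d\<close>. Its product with
  \<open>a + b*d\<close> can vanish for nonzero \<open>b\<close> only if \<open>d\<close> is a/b or
  -a/b, hence in \<open>L\<close>; and if \<open>d\<close> lies in \<open>L\<close>, the set is
  \<open>L\<close> itself.\<close>

lemma subfield_complex_quadratic_extension:
  assumes L: "subfield_complex L" and d: "d^2 \<in> L"
  shows "subfield_complex {a + b * d | a b. a \<in> L \<and> b \<in> L}" (is "subfield_complex ?S")
proof -
  note L' = subfield_complexD[OF L]
  have I: "x \<in> ?S" if "x = a + b * d" "a \<in> L" "b \<in> L" for x a b using that by blast
  have LS: "x \<in> ?S" if "x \<in> L" for x
    by (rule I[of _ x 0]) (use that L'(1) in auto)
  have inv: "inverse x \<in> ?S" if xS: "x \<in> ?S" for x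
  proof -
    obtain a b where x: "x = a + b * d" "a \<in> L" "b \<in> L" using xS by blast
    show ?thesis
    proof (cases "d \<in> L")
      case True
      then have "x \<in> L" unfolding x by (intro L'(2,3) x(2,3))
      then show ?thesis by (intro LS L'(5))
    next
      case False
      have n: "a^2 - b^2 * d^2 \<noteq> 0" if "b \<noteq> 0"
      proof
        assume "a^2 - b^2 * d^2 = 0"
        then have "(a/b)^2 = d^2" using that by (simp add: field_simps)
        then have "d = a/b \<or> d = - (a/b)" by (metis power2_eq_iff)
        then show False using False L'(4,7) x(2,3) by metis
      qed
      show ?thesis
      proof (cases "b = 0")
        case True
        then have "x \<in> L" using x by simp
        then show ?thesis by (intro LS L'(5))
      next
        case b: False
        define w where "w = a^2 - b^2*d^2"
        have "(a + b*d) * (a - b*d) = w"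
          unfolding w_def by (simp add: algebra_simps power2_eq_square)
        then have "(a + b*d) * ((a - b*d) / w) = 1" using n[OF b] unfolding w_def by simp
        moreover have "(a - b*d) / w = a / w + (- b / w) * d" by (simp add: diff_divide_distrib)
        ultimately have "inverse x = a / w + (- b / w) * d"
          unfolding x by (metis inverse_unique)
        moreover have "w \<in> L" unfolding w_def by (intro L' x d)
        then have "a / w \<in> L" "- b / w \<in> L" by (intro L'(4,7) x(2,3); assumption)+
        ultimately show ?thesis by (rule I)
      qed
    qed
  qed
  have uminus: "- x \<in> ?S" if xS: "x \<in> ?S" for x
  proof -
    obtain a b where x: "x = a + b * d" "a \<in> L" "b \<in> L" using xS by blast
    show ?thesis by (rule I[of _ "- a" "- b"]) (simp add: x, intro L' x, intro L' x)
  qed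
  have add_mult: "x + y \<in> ?S \<and> x * y \<in> ?S" if xS: "x \<in> ?S" and yS: "y \<in> ?S" for x y
  proof -
    obtain a b where x: "x = a + b * d" "a \<in> L" "b \<in> L" using xS by blast
    obtain a' b' where y: "y = a' + b' * d" "a' \<in> L" "b' \<in> L" using yS by blast
    have "x + y \<in> ?S"
      by (rule I[of _ "a + a'" "b + b'"]) (simp add: x y algebra_simps, intro L' x y, intro L' x y)
    moreover have "x * y \<in> ?S"
      by (rule I[of _ "a*a' + b*b'*d^2" "a*b' + b*a'"])
        (simp add: x y algebra_simps power2_eq_square, (intro L'(2,3) x(2,3) y(2,3) d)+)
    ultimately show ?thesis ..
  qed
  have rats: "\<rat> \<subseteq> ?S" using LS L'(1) by blast
  show ?thesis
    unfolding subfield_complex_def by (intro conjI ballI rats uminus inv add_mult[THEN conjunct1] add_mult[THEN conjunct2])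
qed

text \<open>The conjugation of the quadratic extension permutes the three roots, hence fixes one of them.\<close>

lemma depressed_cubic_root_descends:
  assumes L: "subfield_complex L" and d: "d^2 \<in> L" and nL: "n \<in> L" "k \<in> L"
    and ab: "a \<in> L" "b \<in> L" and root: "(a + b * d)^3 + n * (a + b * d) + k = 0"
  shows "\<exists>z\<in>L. z^3 + n * z + k = 0"
proof (cases "b = 0 \<or> d \<in> L")
  case True
  then have "a + b * d \<in> L" using ab subfield_complexD[OF L] by auto
  then show ?thesis using root by blast
next
  case False
  note L' = subfield_complexD[OF L]
  define U V where "U = a^3 + 3*a*b^2*d^2 + n*a + k" and "V = 3*a^2*b + b^3*d^2 + n*b"
  have n3: "3 \<in> L" by (intro L'(1)) simp
  have "U + V * d = (a + b * d)^3 + n * (a + b * d) + k"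
    unfolding U_def V_def by (simp add: algebra_simps power2_eq_square power3_eq_cube)
  with root have UV: "U + V * d = 0" by simp
  have UVL: "U \<in> L" "V \<in> L" unfolding U_def V_def by (intro L' ab nL d n3)+
  have "V = 0"
  proof (rule ccontr)
    assume "V \<noteq> 0"
    then have "d = - U / V" using UV by (simp add: field_simps eq_neg_iff_add_eq_0)
    then show False using False UVL L'(4,7) by metis
  qed
  then have "3*a^2 + b^2*d^2 + n = 0" "U = 0"
    using False UV unfolding V_def by (Groebner_Basis.algebra, simp)
  \<comment> \<open>With \<open>a + b*d\<close> also \<open>a - b*d\<close> is a root. The roots sum
    to zero, so the third one is \<open>- 2*a\<close>, which lies in \<open>L\<close>.\<close>
  then have "(- 2 * a)^3 + n * (- 2 * a) + k = 0" unfolding U_def by Groebner_Basis.algebra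
  moreover have "- 2 * a \<in> L" by (intro L' ab) simp
  ultimately show ?thesis by blast
qed

text \<open>Once \<open>L\<close> contains one root of \<open>f_m\<close>, the other two are reached
  by one square root \<open>d\<close>. All roots of \<open>f_n\<close> then lie in this at most
  quadratic extension, and conjugation brings one of them down to \<open>L\<close>. It is applied
  with \<open>L\<close> the cubic field of \<theta> and, for the reducible case, with
  \<open>L\<close> the rationals.\<close>

lemma f_poly_root_descends:
  assumes L: "subfield_complex L" and \<theta>: "\<theta> \<in> L" "\<theta>^3 + of_rat m * \<theta> + of_rat m = 0"
    and eq: "splitting_field (f_poly n) = splitting_field (f_poly m)"
  shows "\<exists>z\<in>L. z^3 + of_rat n * z + of_rat n = 0"
proof -
  note L' = subfield_complexD[OF L]
  define d where "d = csqrt (- 3*\<theta>^2 - 4*of_rat m)"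
  have d: "d ^ 2 = - 3*\<theta>^2 - 4*of_rat m" by (simp add: d_def)
  have dL: "d^2 \<in> L" unfolding d by (intro L' \<theta>) simp_all
  let ?S = "{a + b * d | a b. a \<in> L \<and> b \<in> L}"
  have "splitting_field (f_poly m) \<subseteq> ?S"
  proof (rule splitting_field_minimal[OF subfield_complex_quadratic_extension[OF L dL]])
    fix z :: complex assume "poly (map_poly of_rat (f_poly m)) z = 0"
    then have z: "z^3 + of_rat m * z + of_rat m = 0" by (simp add: poly_f_poly)
    have "4 * (z^3 + of_rat m * z + of_rat m) =
       (z - \<theta>) * (2*z + \<theta> - d) * (2*z + \<theta> + d)"
      using \<theta>(2) d by Groebner_Basis.algebra
    then have "z - \<theta> = 0 \<or> 2*z + \<theta> - d = 0 \<or> 2*z + \<theta> + d = 0" using z by auto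
    then consider "z = \<theta> + 0 * d" | "z = - \<theta>/2 + (1/2) * d" | "z = - \<theta>/2 + (-1/2) * d"
      by (auto simp: field_simps eq_neg_iff_add_eq_0)
    then show "z \<in> ?S"
    proof cases
      case 1
      have "0 \<in> L" by (intro L'(1)) simp
      with 1 \<theta> show ?thesis by blast
    next
      case 2
      moreover have "- \<theta>/2 \<in> L" "1/2 \<in> L" by (intro L' \<theta>, simp)+
      ultimately show ?thesis by blast
    next
      case 3
      moreover have "- \<theta>/2 \<in> L" "-1/2 \<in> L" by (intro L' \<theta>, simp)+
      ultimately show ?thesis by blast
    qed
  qed
  moreover obtain \<beta> where \<beta>: "\<beta>^3 + of_rat n * \<beta> + of_rat n = (0::complex)"
    using depressed_cubic_factors[of "of_rat n" "of_rat n"] by (metis diff_self mult_zero_left)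
  ultimately have "\<beta> \<in> ?S"
    using root_in_splitting_field[of "f_poly n" \<beta>] eq by (auto simp: poly_f_poly)
  then obtain a b where "\<beta> = a + b * d" "a \<in> L" "b \<in> L" by blast
  then show ?thesis
    using depressed_cubic_root_descends[OF L dL, of "of_rat n" "of_rat n" a b] \<beta> L'(1) by simp
qed

section \<open>Trace zero elements of a cubic field\<close>

text \<open>The three roots of the cubic have sum 0 and sum of squares \<open>- 2*m\<close>. Hence
  the constant \<open>2*m*y\<close> cancels the trace of \<open>3*y*\<theta>^2\<close>, and the
  factor 3 keeps the coefficients integral.\<close>

lemma trace_zero_charpoly:
  fixes \<theta> m x y :: "'a :: idom"
  assumes "\<theta>^3 + m * \<theta> + m = 0"
  defines "\<beta> \<equiv> 2*m*y + x*\<theta> + 3*y*\<theta>^2"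
  shows "\<beta>^3 + m*(x^2 + 9*x*y - 3*m*y^2)*\<beta>
    + m*(x^3 - 2*m*x^2*y - 9*m*x*y^2 - m*(2*m + 27)*y^3) = 0"
  using assms(1) unfolding \<beta>_def by Groebner_Basis.algebra

text \<open>Up to the factor \<open>- m^2\<close>, this compares the discriminants of the cubics
  satisfied by \<beta> and by \<theta>. The squared cubic form on the right is the index form: the
  determinant, up to sign, of 1, \<beta>, \<open>\<beta>^2\<close> in the basis 1, \<theta>,
  \<open>\<theta>^2\<close>.\<close>

lemma discriminant_identity:
  fixes m x y :: "'a :: idom"
  shows "4*m*(x^2 + 9*x*y - 3*m*y^2)^3 + 27*(x^3 - 2*m*x^2*y - 9*m*x*y^2 - m*(2*m + 27)*y^3)^2
    = (4*m + 27)*(x^3 + 9*m*x*y^2 + 27*m*y^3)^2"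
  by Groebner_Basis.algebra

text \<open>Division by \<open>F^2\<close> gives the compact form \<open>m*P^3 / F^2\<close> of the
  parametrisation, from which both divisibility and the root of \<open>f_n\<close> are read
  off.\<close>

lemma n_param_numerator:
  fixes m x y :: "'a :: idom"
  shows "m*(x^3 - 2*m*x^2*y - 9*m*x*y^2 - m*(2*m + 27)*y^3)^2
    + m*(4*m + 27)*y*(x^2 + 9*x*y + 27*y^2 + m*y^2)*(x^3 - m*x^2*y - m^2*y^3)
    = m*(x^2 + 9*x*y - 3*m*y^2)^3"
  by Groebner_Basis.algebra

text \<open>The combination of \<beta> and \<open>\<beta>^2\<close> is chosen to remove
  \<open>\<theta>^2\<close>; what remains in front of \<theta> is the index form of
  \<open>discriminant_identity\<close>.\<close>

lemma trace_zero_inverse: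
  fixes \<theta> m x y :: "'a :: idom"
  assumes "\<theta>^3 + m * \<theta> + m = 0"
  defines "\<beta> \<equiv> 2*m*y + x*\<theta> + 3*y*\<theta>^2"
  shows "(x^3 + 9*m*x*y^2 + 27*m*y^3)*\<theta>
    = (x^2 + 3*m*y^2)*\<beta> - 3*y*\<beta>^2 - (2*m*y*(x^2 + 3*m*y^2) - 3*y*(4*m^2*y^2 - 6*m*x*y))"
  using assms(1) unfolding \<beta>_def by Groebner_Basis.algebra

text \<open>The cofactors solve the linear system that expresses a monomial of degree 11 by
  \<open>mP\<^sup>3\<close> and \<open>F\<^sup>2\<close> over \<open>\<rat>(m)\<close>.\<close>

lemma resultant_identity_x:
  fixes m x y :: int
  defines "P \<equiv> x^2 + 9*x*y - 3*m*y^2"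
    and "F \<equiv> x^3 - 2*m*x^2*y - 9*m*x*y^2 - m*(2*m + 27)*y^3"
  shows "((1062882*m + 688905*m^2 + 290871*m^3 + 32751*m^4 + 1024*m^5)*x^5 +
      (1594323*m^2 + 944784*m^3 - 155277*m^4 - 20412*m^5)*x^4*y +
      (- 4782969*m^2 - 2302911*m^3 - 2558790*m^4 - 171801*m^5 + 1980*m^6)*x^3*y^2 +
      (- 14348907*m^2 - 24446286*m^3 - 18777582*m^4 - 1930392*m^5 - 49464*m^6)*x^2*y^3 +
      (- 43046721*m^3 - 52612659*m^4 - 6908733*m^5 - 227448*m^6 + 972*m^7)*x*y^4 +
      (- 71744535*m^4 - 15943230*m^5 - 1180980*m^6 - 29160*m^7)*y^5) * (m*P^3)
    + ((14348907*m + 9565938*m^2 + 2460375*m^3 + 175689*m^4 + 1809*m^5)*x^5 +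
      (28697814*m^2 + 18068994*m^3 + 1043199*m^4 - 26244*m^5)*x^4*y +
      (33480783*m^3 - 9388791*m^4 - 1095687*m^5 - 6318*m^6)*x^3*y^2 +
      (- 57927069*m^4 - 2952450*m^5 + 138510*m^6)*x^2*y^3 +
      (22320522*m^5 + 1830519*m^6 + 6561*m^7)*x*y^4 +
      (- 2657205*m^6 - 196830*m^7)*y^5) * F^2
    = m*(4*m + 27)^5 * x^11"
  unfolding P_def F_def by Groebner_Basis.algebra

lemma resultant_identity_y:
  fixes m x y :: int
  defines "P \<equiv> x^2 + 9*x*y - 3*m*y^2"
    and "F \<equiv> x^3 - 2*m*x^2*y - 9*m*x*y^2 - m*(2*m + 27)*y^3"
  shows "((- 15)*x^5 +
      (27 + 57*m)*x^4*y +
      (- 27 + 176*m - 48*m^2)*x^3*y^2 +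
      (405*m - 375*m^2 - 12*m^3)*x^2*y^3 +
      (- 972*m - 2034*m^2 - 156*m^3)*x*y^4 +
      (1458*m - 3591*m^2 - 636*m^3 - 28*m^4)*y^5) * (m*P^3)
    + ((15*m)*x^5 +
      (378*m + 3*m^2)*x^4*y +
      (2943*m - 68*m^2)*x^3*y^2 +
      (5103*m - 1809*m^2 - 26*m^3)*x^2*y^3 +
      (- 13122*m - 7290*m^2 + 45*m^3)*x*y^4 +
      (19683*m + 11664*m^2 + 2538*m^3 + 67*m^4)*y^5) * F^2
    = m^3*(4*m + 27)^5 * y^11"
  unfolding P_def F_def by Groebner_Basis.algebra

text \<open>The two elimination identities show that the square divides the same constant times
  \<open>x^11\<close> and times \<open>y^11\<close>; coprimality removes these powers.\<close>

lemma F_form_sq_dvd: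
  fixes m x y :: int
  assumes "coprime x y" and dvd: "(F_form m x y)^2 dvd m*(x^2 + 9*x*y - 3*m*y^2)^3"
  shows "(F_form m x y)^2 dvd m^3*(4*m + 27)^5"
proof -
  let ?F = "F_form m x y" and ?T = "m^3*(4*m + 27)^5"
  have "?F^2 dvd m*(4*m + 27)^5 * x^11"
    unfolding resultant_identity_x[symmetric, of m x y] F_form_def[symmetric]
    by (intro dvd_add dvd_mult dvd dvd_refl)
  \<comment> \<open>The factor \<open>m^2\<close> makes the constant agree with that of the identity
    for \<open>y^11\<close>.\<close>
  then have "?F^2 dvd m^2 * (m*(4*m + 27)^5 * x^11)" by (rule dvd_mult)
  also have "m^2 * (m*(4*m + 27)^5 * x^11) = ?T * x^11"
    by (simp add: power2_eq_square power3_eq_cube)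
  finally have x: "?F^2 dvd ?T * x^11" .
  have y: "?F^2 dvd ?T * y^11"
    unfolding resultant_identity_y[symmetric, of m y x] F_form_def[symmetric]
    by (intro dvd_add dvd_mult dvd dvd_refl)
  have "?F^2 dvd gcd (?T * x^11) (?T * y^11)" using x y by (rule gcd_greatest)
  also have "gcd (?T * x^11) (?T * y^11) = normalize ?T * gcd (x^11) (y^11)"
    by (metis gcd_mult_left normalize_mult normalize_gcd)
  also have "gcd (x^11) (y^11) = 1"
    using assms(1) by (metis coprime_iff_gcd_eq_1 coprime_power_left_iff coprime_power_right_iff)
  finally show ?thesis by simp
qed

section \<open>The parametrisation and equality of splitting fields\<close>

lemma n_param_eq:
  assumes "F_form m x y \<noteq> 0"
  shows "n_param m x y = of_int (m*(x^2 + 9*x*y - 3*m*y^2)^3) / of_int ((F_form m x y)^2)"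
proof -
  have "m*(F_form m x y)^2 + m*(4*m + 27)*y*(x^2 + 9*x*y + 27*y^2 + m*y^2)*(x^3 - m*x^2*y - m^2*y^3)
    = m*(x^2 + 9*x*y - 3*m*y^2)^3"
    unfolding F_form_def by (rule n_param_numerator)
  moreover have "n_param m x y = (of_int (m*(F_form m x y)^2 +
      m*(4*m + 27)*y*(x^2 + 9*x*y + 27*y^2 + m*y^2)*(x^3 - m*x^2*y - m^2*y^3))) / of_int ((F_form m x y)^2)"
    unfolding n_param_def of_int_add using assms by (simp add: add_divide_distrib)
  ultimately show ?thesis by simp
qed

text \<open>The map \<open>z\<close> sends roots of \<open>f_m\<close> to roots of
  \<open>f_n\<close> by a rational polynomial, and \<open>recover\<close> inverts it rationally. The
  conditions on \<open>n\<close> ensure that neither \<open>P\<close> nor the index form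
  \<open>C\<close> vanishes, so both directions make sense.\<close>

lemma splitting_field_n_param:
  assumes m: "m \<noteq> 0" and F: "F_form m x y \<noteq> 0"
    and n: "n = n_param m x y" "n \<noteq> 0" "n \<noteq> - 27 / 4"
  shows "splitting_field (f_poly n) = splitting_field (f_poly (of_int m))"
proof -
  define P where "P = x^2 + 9*x*y - 3*m*y^2"
  define C where "C = x^3 + 9*m*x*y^2 + 27*m*y^3"
  have n': "n = of_int (m*P^3) / of_int ((F_form m x y)^2)"
    using n_param_eq[OF F] n(1) P_def by simp
  then have P0: "P \<noteq> 0" using n(2) by auto
  \<comment> \<open>A vanishing index form gives \<open>4*m*P^3 = - 27*F^2\<close> by the
    discriminant identity, that is, the excluded value \<open>n = - 27/4\<close>.\<close>
  have C0: "C \<noteq> 0"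
  proof
    assume "C = 0"
    then have "4*m*P^3 + 27*(F_form m x y)^2 = 0"
      using discriminant_identity[of m x y] unfolding P_def C_def F_form_def by simp
    then have "m*P^3*4 = - 27*(F_form m x y)^2" by simp
    then have "(of_int (m*P^3*4) :: rat) = of_int (- 27*(F_form m x y)^2)" by (simp only:)
    then have "of_int (m*P^3) * 4 = (- 27 * of_int ((F_form m x y)^2) :: rat)" by simp
    then have "n * 4 = - 27" unfolding n' using F by (simp only: times_divide_eq_left) simp
    then show False using n(3) by simp
  qed
  define M x' y' p c f :: complex where "M = of_int m" and "x' = of_int x" and "y' = of_int y"
    and "p = of_int P" and "c = of_int C" and "f = of_int (F_form m x y)"
  define N :: complex where "N = of_rat n"
  note cdefs = M_def x'_def y'_def
  have p: "p = x'^2 + 9*x'*y' - 3*M*y'^2" unfolding p_def P_def cdefs by simp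
  have c: "c = x'^3 + 9*M*x'*y'^2 + 27*M*y'^3" unfolding c_def C_def cdefs by simp
  have f: "f = x'^3 - 2*M*x'^2*y' - 9*M*x'*y'^2 - M*(2*M + 27)*y'^3"
    unfolding f_def F_form_def cdefs by simp
  have nz: "p \<noteq> 0" "c \<noteq> 0" "f \<noteq> 0" "M \<noteq> 0"
    using P0 C0 F m by (simp_all add: p_def c_def f_def M_def)
  have N: "N = M * p^3 / f^2"
    unfolding N_def n' M_def p_def f_def by (simp add: of_rat_divide of_rat_mult of_rat_power)
  define b where "b = (\<lambda>\<theta>. 2*M*y' + x'*\<theta> + 3*y'*\<theta>^2)"
  \<comment> \<open>Since \<open>b \<theta>\<close> satisfies \<open>X^3 + M*p*X + M*f = 0\<close>,
    scaling by \<open>p/f\<close> makes the linear and the constant coefficient both equal to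
    \<open>M*p^3 / f^2\<close>.\<close>
  define z where "z = (\<lambda>\<theta>. p / f * b \<theta>)"
  have root_m: "poly (map_poly of_rat (f_poly (of_int m))) w = 0 \<longleftrightarrow> w^3 + M*w + M = 0" for w :: complex
    by (simp add: poly_f_poly M_def)
  have root_n: "poly (map_poly of_rat (f_poly n)) w = 0 \<longleftrightarrow> w^3 + N*w + N = 0" for w :: complex
    by (simp add: poly_f_poly N_def)
  have z: "(z w)^3 + N*(z w) + N = 0" if "w^3 + M*w + M = 0" for w
  proof -
    have "(b w)^3 + M*p*b w + M*f = 0"
      using trace_zero_charpoly[OF that, of y' x'] unfolding b_def p f .
    moreover have "(z w)^3 + N*(z w) + N = (p/f)^3 * ((b w)^3 + M*p*b w + M*f)"
      unfolding z_def N using nz by (simp add: field_simps power2_eq_square power3_eq_cube)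
    ultimately show ?thesis by simp
  qed
  have recover: "w = ((x'^2 + 3*M*y'^2)*(f/p * z w) - 3*y'*(f/p * z w)^2
      - (2*M*y'*(x'^2 + 3*M*y'^2) - 3*y'*(4*M^2*y'^2 - 6*M*x'*y'))) / c" if "w^3 + M*w + M = 0" for w
  proof -
    have bz: "b w = f/p * z w" using nz by (simp add: z_def)
    have "c * w = (x'^2 + 3*M*y'^2)*b w - 3*y'*(b w)^2
      - (2*M*y'*(x'^2 + 3*M*y'^2) - 3*y'*(4*M^2*y'^2 - 6*M*x'*y'))"
      using trace_zero_inverse[OF that, of x' y'] unfolding b_def c .
    then show ?thesis unfolding bz using nz(2) by (metis nonzero_mult_div_cancel_left)
  qed
  have consts_in: "M \<in> S" "x' \<in> S" "y' \<in> S" "p \<in> S" "c \<in> S" "f \<in> S" "numeral k \<in> S"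
    if "subfield_complex S" for S k
    unfolding M_def x'_def y'_def p_def c_def f_def
    by (rule subfield_complexD(1)[OF that], simp)+
  show ?thesis
  proof
    let ?S = "splitting_field (f_poly (of_int m))"
    note S = subfield_complex_splitting_field[of "f_poly (of_int m)"]
    note S' = subfield_complexD[OF S]
    have zS: "z w \<in> ?S" if "w^3 + M*w + M = 0" for w
    proof -
      have "w \<in> ?S" using that root_m by (simp add: root_in_splitting_field)
      then show ?thesis unfolding z_def b_def
        by (intro S'(2,3,7,8) consts_in[OF S])
    qed
    show "splitting_field (f_poly n) \<subseteq> ?S"
    proof (rule splitting_field_minimal[OF S])
      fix w :: complex assume "poly (map_poly of_rat (f_poly n)) w = 0"
      then have w: "w^3 + N*w + N = 0" by (simp add: root_n)
      obtain r s t where rst: "r + s + t = 0" "r*s + s*t + t*r = M"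
        "\<And>z. z ^ 3 + M*z + M = (z - r)*(z - s)*(z - t)"
        using depressed_cubic_factors[of M M] by metis
      \<comment> \<open>A triple root would be 0 because the roots sum to zero, and then
        \<open>M = 0\<close>. Two distinct roots suffice: their images are distinct roots of
        \<open>f_n\<close>, and the remaining root is minus their sum.\<close>
      have "\<exists>u v. u \<noteq> v \<and> u^3 + M*u + M = 0 \<and> v^3 + M*v + M = 0"
      proof (rule ccontr)
        assume "\<not> ?thesis"
        then have "r = s" "s = t" using rst(3) by auto
        then have "3 * r = 0" "3 * r^2 = M" using rst(1,2) by (auto simp: power2_eq_square)
        then show False using nz by simp
      qed
      then obtain u v where uv: "u \<noteq> v" "u^3 + M*u + M = 0" "v^3 + M*v + M = 0" by blast
      have d: "z u \<noteq> z v" using recover[OF uv(2)] recover[OF uv(3)] uv(1) by metis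
      have e: "(w - z u) * (w - z v) * (z u - z v) * (w + z u + z v) = 0"
        using w z[OF uv(2)] z[OF uv(3)] by Groebner_Basis.algebra
      have "w = z u \<or> w = z v \<or> w + (z u + z v) = 0"
        using e d by (auto simp: add.assoc)
      then have "w = z u \<or> w = z v \<or> w = - (z u + z v)"
        unfolding eq_neg_iff_add_eq_0 .
      then show "w \<in> ?S"
        using zS[OF uv(2)] zS[OF uv(3)] S'(4)[OF S'(2)[OF zS[OF uv(2)] zS[OF uv(3)]]] by metis
    qed
  next
    let ?S = "splitting_field (f_poly n)"
    note S = subfield_complex_splitting_field[of "f_poly n"]
    note S' = subfield_complexD[OF S]
    show "splitting_field (f_poly (of_int m)) \<subseteq> ?S"
    proof (rule splitting_field_minimal[OF S])
      fix w :: complex assume "poly (map_poly of_rat (f_poly (of_int m))) w = 0"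
      then have w: "w^3 + M*w + M = 0" by (simp add: root_m)
      have zw: "z w \<in> ?S" using z[OF w] root_n by (simp add: root_in_splitting_field)
      show "w \<in> ?S"
        by (subst recover[OF w]) (intro S'(2,3,6,7,8) consts_in[OF S] zw)
    qed
  qed
qed

lemma f_poly_no_rational_root:
  fixes n :: int and t :: rat
  assumes "n \<noteq> 0" "n \<noteq> - 8"
  shows "t^3 + of_int n * t + of_int n \<noteq> 0"
  using f_poly_rational_root assms by blast

text \<open>The polynomial for -8 has the rational root -2, so the descent works over the rationals
  and gives \<open>f_n\<close> a rational root as well.\<close>

lemma splitting_field_minus8:
  assumes "n \<noteq> 0" "splitting_field (f_poly (of_int n)) = splitting_field (f_poly (of_int (- 8)))"
  shows "n = - 8"
proof -
  have "\<exists>z\<in>\<rat>. z^3 + of_rat (of_int n) * z + of_rat (of_int n) = (0 :: complex)"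
    by (rule f_poly_root_descends[OF subfield_complex_Rats _ _ assms(2), of "- 2"])
      (simp_all add: of_rat_minus)
  then obtain r :: rat where "of_rat r ^ 3 + of_rat (of_int n) * of_rat r + of_rat (of_int n) = (0 :: complex)"
    by (auto elim: Rats_cases)
  then have "of_rat (r^3 + of_int n * r + of_int n) = (0 :: complex)"
    by (simp only: of_rat_add of_rat_mult of_rat_power)
  then have "r^3 + of_int n * r + of_int n = 0" by (simp only: of_rat_eq_0_iff)
  then show ?thesis using f_poly_rational_root assms(1) by blast
qed

text \<open>A root of \<open>f_n\<close> in the cubic field is split as \<open>z = e + b\<close>
  with \<open>b\<close> of the trace zero shape. Subtracting the cubic of \<open>b\<close> from that
  of \<open>z\<close> leaves a quadratic relation for \<open>z\<close>, which must be trivial; its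
  coefficients give \<open>e = 0\<close> and the two equations.\<close>

lemma splitting_field_eq_imp_forms:
  fixes m n :: int
  assumes m: "m \<noteq> 0" "m \<noteq> - 8" and n: "n \<noteq> 0" "n \<noteq> - 8"
    and eq: "splitting_field (f_poly (of_int n)) = splitting_field (f_poly (of_int m))"
  obtains x y :: rat where "of_int n = of_int m * (x^2 + 9*x*y - 3*of_int m*y^2)"
    "of_int n = of_int m * (x^3 - 2*of_int m*x^2*y - 9*of_int m*x*y^2 - of_int m*(2*of_int m + 27)*y^3)"
proof -
  obtain \<theta> where \<theta>: "\<theta>^3 + of_rat (of_int m) * \<theta> + of_rat (of_int m) = (0::complex)"
    using depressed_cubic_factors[of "of_rat (of_int m)" "of_rat (of_int m)"]
    by (metis diff_self mult_zero_left)
  have L: "subfield_complex (cubic_span \<theta>)"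
    by (rule subfield_complex_cubic_span[OF \<theta> f_poly_no_rational_root[OF m]])
  have \<theta>L: "\<theta> \<in> cubic_span \<theta>"
    unfolding cubic_span_def by (rule CollectI, rule exI[of _ 0], rule exI[of _ 1], rule exI[of _ 0]) simp
  obtain z where z: "z \<in> cubic_span \<theta>" "z^3 + of_rat (of_int n) * z + of_rat (of_int n) = 0"
    using f_poly_root_descends[OF L \<theta>L \<theta> eq] by blast
  then obtain p q r where pqr: "z = of_rat p + of_rat q * \<theta> + of_rat r * \<theta>^2"
    unfolding cubic_span_def by blast
  \<comment> \<open>The coordinates are matched with
    \<open>2*m*y + x*\<theta> + 3*y*\<theta>^2\<close>; \<open>e\<close> is the rational part left
    over, a third of the trace.\<close>
  define x y e where "x = q" and "y = r / 3" and "e = p - 2 * of_int m * y"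
  define P F where "P = x^2 + 9*x*y - 3*of_int m*y^2"
    and "F = x^3 - 2*of_int m*x^2*y - 9*of_int m*x*y^2 - of_int m*(2*of_int m + 27)*y^3"
  define M N x' y' E where "M = complex_of_rat (of_int m)" and "N = complex_of_rat (of_int n)"
    and "x' = complex_of_rat x" and "y' = complex_of_rat y" and "E = complex_of_rat e"
  note defs = M_def N_def x'_def y'_def E_def
  define b where "b = 2*M*y' + x'*\<theta> + 3*y'*\<theta>^2"
  have r: "of_rat r = 3 * y'" unfolding y'_def y_def by (simp add: of_rat_divide)
  have p: "of_rat p = E + 2 * M * y'" unfolding defs e_def by (simp add: of_rat_diff of_rat_mult)
  have zb: "z = E + b" unfolding pqr r p b_def x'_def x_def by simp
  have PF: "of_rat P = x'^2 + 9*x'*y' - 3*M*y'^2"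
    "of_rat F = x'^3 - 2*M*x'^2*y' - 9*M*x'*y'^2 - M*(2*M + 27)*y'^3"
    unfolding P_def F_def defs
    by (simp_all add: of_rat_diff of_rat_add of_rat_mult of_rat_power)
  have b: "b^3 + M*of_rat P*b + M*of_rat F = 0"
    unfolding PF b_def by (rule trace_zero_charpoly) (use \<theta> M_def in simp)
  have "of_rat (of_int n + e^3 + of_int m*P*e - of_int m*F) + of_rat (of_int n - 3*e^2 - of_int m*P) * z
      + of_rat (3*e) * z^2 = (N + E^3 + M*of_rat P*E - M*of_rat F) + (N - 3*E^2 - M*of_rat P) * z + 3*E*z^2"
    unfolding defs by (simp add: of_rat_diff of_rat_add of_rat_mult of_rat_power)
  also have "\<dots> = (z^3 + N*z + N) - (b^3 + M*of_rat P*b + M*of_rat F)"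
    unfolding zb by (simp add: algebra_simps power2_eq_square power3_eq_cube)
  also have "\<dots> = 0" using b z(2) unfolding N_def by simp
  finally have rel: "of_rat (of_int n + e^3 + of_int m*P*e - of_int m*F)
      + of_rat (of_int n - 3*e^2 - of_int m*P) * z + of_rat (3*e) * z^2 = 0" .
  have "of_int n + e^3 + of_int m*P*e - of_int m*F = 0 \<and> of_int n - 3*e^2 - of_int m*P = 0 \<and> 3*e = 0"
    by (rule cubic_independent[of z 0 "of_int n" "of_int n", OF _ _ rel])
      (use z(2) f_poly_no_rational_root[OF n] in simp_all)
  then have "of_int n = of_int m * P" "of_int n = of_int m * F" by auto
  then show thesis using that unfolding P_def F_def by blast
qed

text \<open>The rational pair is replaced by coprime integers. The quadratic and cubic forms scale
  by \<open>l^2\<close> and \<open>l^3\<close>, so comparing a cube with a square eliminates the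
  scaling factor.\<close>

lemma splitting_field_eq_imp_n_param:
  fixes m n :: int
  assumes m: "m \<noteq> 0" and n: "n \<noteq> 0" "n \<noteq> m"
    and eq: "splitting_field (f_poly (of_int n)) = splitting_field (f_poly (of_int m))"
  obtains x y where "m \<noteq> - 8" "coprime x y" "y > 0" "(F_form m x y)^2 dvd m^3*(4*m + 27)^5"
    "of_int n = n_param m x y"
proof -
  have m8: "m \<noteq> - 8" using splitting_field_minus8[OF n(1)] eq n(2) by auto
  have n8: "n \<noteq> - 8" using splitting_field_minus8[OF m] eq n(2) by auto
  obtain x y :: rat where P: "of_int n = of_int m * (x^2 + 9*x*y - 3*of_int m*y^2)"
    and F: "of_int n = of_int m * (x^3 - 2*of_int m*x^2*y - 9*of_int m*x*y^2 - of_int m*(2*of_int m + 27)*y^3)"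
    using splitting_field_eq_imp_forms[OF m m8 n(1) n8 eq] .
  \<comment> \<open>With \<open>y = 0\<close> the two equations force \<open>x = 1\<close>, which is
    the identity substitution and gives \<open>n = m\<close>.\<close>
  have y: "y \<noteq> 0"
  proof
    assume "y = 0"
    then have e: "of_int n = of_int m * x^2" "of_int n = of_int m * x^3" using P F by auto
    then have "x^2 * (x - 1) = 0" using m by (simp add: algebra_simps power2_eq_square power3_eq_cube)
    moreover have "x \<noteq> 0" using e n by auto
    ultimately have "x = 1" by simp
    then show False using e n by simp
  qed
  obtain x' y' where q: "quotient_of (x / y) = (x', y')" by force
  have y': "y' > 0" "coprime x' y'" "x / y = of_int x' / of_int y'"
    using q quotient_of_denom_pos quotient_of_coprime quotient_of_div by auto
  define l where "l = y / of_int y'"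
  have xy: "x = l * of_int x'" "y = l * of_int y'"
    using y' y by (simp_all add: l_def field_simps)
  define P' where "P' = x'^2 + 9*x'*y' - 3*m*y'^2"
  let ?F = "F_form m x' y'"
  have P2: "of_int n = of_int m * l^2 * (of_int P' :: rat)"
    unfolding P xy P'_def by (simp add: algebra_simps power2_eq_square)
  have F2: "of_int n = of_int m * l^3 * (of_int ?F :: rat)"
    unfolding F xy F_form_def by (simp add: algebra_simps power2_eq_square power3_eq_cube)
  have l: "l \<noteq> 0" and F0: "?F \<noteq> 0" using F2 n(1) by auto
  \<comment> \<open>Both sides equal \<open>n^3\<close>: on the left \<open>n\<close> times the
    square of the cubic-form expression, on the right the cube of the quadratic-form
    expression.\<close>
  have "of_int n * (of_int m^2 * l^6 * of_int ?F^2) = (of_int m * (of_int P')^3) * (of_int m^2 * l^6 :: rat)"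
  proof -
    have "of_int n * (of_int m^2 * l^6 * of_int ?F^2) = of_int n * (of_int m * l^3 * of_int ?F :: rat)^2"
      by (simp add: power_mult_distrib flip: power_mult)
    also have "\<dots> = (of_int m * l^2 * of_int P')^3"
      unfolding F2[symmetric] P2[symmetric] by (simp add: power3_eq_cube power2_eq_square)
    also have "\<dots> = (of_int m * (of_int P')^3) * (of_int m^2 * l^6 :: rat)"
      by (simp add: power_mult_distrib power3_eq_cube power2_eq_square eval_nat_numeral)
    finally show ?thesis .
  qed
  then have "of_int n * of_int ?F^2 = (of_int m * (of_int P')^3 :: rat)"
    using m l by simp
  then have nF: "of_int n * of_int (?F^2) = (of_int (m * P'^3) :: rat)" by simp
  then have "n * ?F^2 = m * P'^3" by (simp only: of_int_mult[symmetric] of_int_eq_iff)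
  then have "?F^2 dvd m * P'^3" by (metis dvd_triv_right)
  then have "?F^2 dvd m^3*(4*m + 27)^5" using F_form_sq_dvd[OF y'(2)] unfolding P'_def by blast
  moreover have "of_int n = n_param m x' y'"
    unfolding n_param_eq[OF F0] P'_def[symmetric] nF[symmetric] using F0 by simp
  ultimately show thesis using that m8 y' by blast
qed

section \<open>Thue's theorem for cubic forms\<close>

text \<open>The vectors with entries between 0 and \<open>B\<close> outnumber the possible values of
  the \<open>r\<close> linear forms, so two of them share all values. Their difference is the
  desired solution.\<close>

lemma siegel_pigeonhole:
  fixes a :: "nat \<Rightarrow> nat \<Rightarrow> int" and K B r s :: nat
  assumes a: "\<And>i j. i < r \<Longrightarrow> j < s \<Longrightarrow> \<bar>a i j\<bar> \<le> int K"
    and count: "(2*s*K*B + 1) ^ r < (B + 1) ^ s"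
  obtains x :: "nat \<Rightarrow> int" where "\<exists>j<s. x j \<noteq> 0" "\<And>j. j < s \<Longrightarrow> \<bar>x j\<bar> \<le> int B"
    "\<And>i. i < r \<Longrightarrow> (\<Sum>j<s. a i j * x j) = 0"
proof -
  define D where "D = {..<s} \<rightarrow>\<^sub>E {0..int B}"
  define R where "R = {..<r} \<rightarrow>\<^sub>E {- int (s*K*B)..int (s*K*B)}"
  define \<phi> where "\<phi> = (\<lambda>x. \<lambda>i\<in>{..<r}. \<Sum>j<s. a i j * x j)"
  have cD: "card D = (B + 1) ^ s"
    unfolding D_def by (simp add: card_PiE nat_add_distrib)
  have cR: "card R = (2*s*K*B + 1) ^ r"
  proof -
    have "card {- int (s*K*B)..int (s*K*B)} = 2*s*K*B + 1"
      by (simp only: card_atLeastAtMost_int)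
    then show ?thesis unfolding R_def by (simp add: card_PiE)
  qed
  have fR: "finite R" unfolding R_def by (intro finite_PiE) auto
  have maps: "\<phi> x \<in> R" if x: "x \<in> D" for x
  proof -
    have "(\<Sum>j<s. a i j * x j) \<in> {- int (s*K*B)..int (s*K*B)}" if i: "i < r" for i
    proof -
      have "\<bar>\<Sum>j<s. a i j * x j\<bar> \<le> (\<Sum>j<s. \<bar>a i j * x j\<bar>)" by (rule sum_abs)
      also have "\<dots> \<le> (\<Sum>j<s. int K * int B)"
      proof (rule sum_mono)
        fix j assume j: "j \<in> {..<s}"
        then have "x j \<in> {0..int B}" by (rule PiE_mem[OF x[unfolded D_def]])
        then show "\<bar>a i j * x j\<bar> \<le> int K * int B"
          using a[OF i, of j] j unfolding abs_mult by (intro mult_mono) auto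
      qed
      also have "\<dots> = int (s*K*B)" by simp
      finally show ?thesis unfolding atLeastAtMost_iff abs_le_iff by linarith
    qed
    then show ?thesis unfolding R_def \<phi>_def by (intro PiE_I) simp_all
  qed
  have "\<not> inj_on \<phi> D"
    using card_inj_on_le[of \<phi> D R] maps fR cD cR count by auto
  then obtain u v where uv: "u \<in> D" "v \<in> D" "\<phi> u = \<phi> v" "u \<noteq> v" unfolding inj_on_def by blast
  have uvB: "u j \<in> {0..int B}" "v j \<in> {0..int B}" if "j < s" for j
    using PiE_mem[OF uv(1)[unfolded D_def]] PiE_mem[OF uv(2)[unfolded D_def]] that by simp_all
  show thesis
  proof (rule that[of "\<lambda>j. u j - v j"])
    show "\<exists>j<s. u j - v j \<noteq> 0"
    proof (rule ccontr)
      assume "\<not> ?thesis"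
      then have "u j = v j" if "j \<in> {..<s}" for j using that by auto
      then have "u = v" using uv(1,2) unfolding D_def by (intro PiE_ext) auto
      then show False using uv(4) by blast
    qed
    show "\<bar>u j - v j\<bar> \<le> int B" if "j < s" for j using uvB[OF that] by auto
    show "(\<Sum>j<s. a i j * (u j - v j)) = 0" if "i < r" for i
      using fun_cong[OF uv(3), of i] that
      by (simp add: \<phi>_def right_diff_distrib sum_subtractf)
  qed
qed

section \<open>Taylor shifts, order of vanishing and size of Taylor coefficients\<close>

lemma pcompose_power:
  fixes p q :: "'a :: comm_semiring_1 poly"
  shows "(p ^ i) \<circ>\<^sub>p q = (p \<circ>\<^sub>p q) ^ i"
  by (induction i) (simp_all only: power_0 power_Suc pcompose_mult pcompose_1)

text \<open>The coefficient of the shifted polynomial is the j-th derivative at \<open>x\<close>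
  divided by j factorial. Working with it keeps integrality and avoids factorials in all
  estimates.\<close>

lemma coeff_pcompose_shift:
  fixes p :: "complex poly"
  assumes "degree p \<le> N"
  shows "coeff (p \<circ>\<^sub>p [:x, 1:]) j = (\<Sum>i\<le>N. coeff p i * of_nat (i choose j) * x ^ (i - j))"
proof -
  have lin: "coeff ([:x, 1:] ^ i) j = of_nat (i choose j) * x ^ (i - j)" for i
  proof (cases "j \<le> i")
    case True
    then show ?thesis by (simp add: coeff_linear_poly_power)
  next
    case False
    have "degree ([:x, 1:] ^ i) \<le> i" using degree_power_le[of "[:x, 1:]" i] by simp
    then show ?thesis using False by (simp add: coeff_eq_0)
  qed
  have pow: "([:0, 1:] ^ i) \<circ>\<^sub>p [:x, 1:] = [:x, 1:] ^ i" for i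
    by (simp add: pcompose_power pcompose_pCons)
  have "p \<circ>\<^sub>p [:x, 1:] = (\<Sum>i\<le>N. monom (coeff p i) i) \<circ>\<^sub>p [:x, 1:]"
    by (simp add: poly_as_sum_of_monoms'[OF assms])
  also have "\<dots> = (\<Sum>i\<le>N. smult (coeff p i) ([:x, 1:] ^ i))"
    unfolding pcompose_sum monom_altdef pcompose_smult pow ..
  finally show ?thesis by (simp add: coeff_sum lin mult.assoc)
qed

lemma pcompose_shift_shift:
  fixes p :: "'a :: comm_ring_1 poly"
  shows "(p \<circ>\<^sub>p [:x, 1:]) \<circ>\<^sub>p [:y, 1:] = p \<circ>\<^sub>p [:x + y, 1:]"
  by (simp add: pcompose_assoc[symmetric] pcompose_pCons)

text \<open>The shift is an invertible substitution that carries \<open>X - x\<close> to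
  \<open>X\<close>, so vanishing to order \<open>M\<close> means that the first \<open>M\<close>
  Taylor coefficients are zero.\<close>

lemma linear_power_dvd_iff_coeff_shift:
  fixes p :: "complex poly"
  shows "[:- x, 1:] ^ M dvd p \<longleftrightarrow> (\<forall>j<M. coeff (p \<circ>\<^sub>p [:x, 1:]) j = 0)"
proof -
  have inv: "(p \<circ>\<^sub>p [:x, 1:]) \<circ>\<^sub>p [:- x, 1:] = p"
    by (simp add: pcompose_shift_shift pcompose_idR)
  have "[:- x, 1:] ^ M dvd p \<longleftrightarrow> monom 1 M dvd p \<circ>\<^sub>p [:x, 1:]"
  proof
    assume "[:- x, 1:] ^ M dvd p"
    then obtain q where "p = [:- x, 1:] ^ M * q" by blast
    then have "p \<circ>\<^sub>p [:x, 1:] = monom 1 M * (q \<circ>\<^sub>p [:x, 1:])"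
      by (simp add: pcompose_mult pcompose_power pcompose_pCons monom_altdef)
    then show "monom 1 M dvd p \<circ>\<^sub>p [:x, 1:]" by (metis dvd_triv_left)
  next
    assume "monom 1 M dvd p \<circ>\<^sub>p [:x, 1:]"
    then obtain q where "p \<circ>\<^sub>p [:x, 1:] = [:0, 1:] ^ M * q" by (auto simp: monom_altdef)
    then have "p = [:- x, 1:] ^ M * (q \<circ>\<^sub>p [:- x, 1:])"
      using inv by (simp add: pcompose_mult pcompose_power pcompose_pCons)
    then show "[:- x, 1:] ^ M dvd p" by (metis dvd_triv_left)
  qed
  then show ?thesis by (simp add: monom_1_dvd_iff')
qed

lemma norm_coeff_shift_le:
  fixes p :: "complex poly"
  assumes p: "degree p \<le> N" "\<And>i. norm (coeff p i) \<le> H" and x: "norm x \<le> \<rho>" "1 \<le> \<rho>"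
  shows "norm (coeff (p \<circ>\<^sub>p [:x, 1:]) j) \<le> 4 ^ N * \<rho> ^ N * H"
proof -
  have H: "0 \<le> H" using p(2)[of 0] norm_ge_zero order_trans by blast
  have "norm (coeff (p \<circ>\<^sub>p [:x, 1:]) j) \<le> (\<Sum>i\<le>N. norm (coeff p i * of_nat (i choose j) * x ^ (i - j)))"
    unfolding coeff_pcompose_shift[OF p(1)] by (rule norm_sum)
  also have "\<dots> \<le> (\<Sum>i\<le>N. H * 2 ^ N * \<rho> ^ N)"
  proof (rule sum_mono)
    fix i assume i: "i \<in> {..N}"
    have "real (i choose j) \<le> 2 ^ i" using binomial_le_pow2[of i j] by (metis of_nat_le_iff of_nat_numeral of_nat_power)
    also have "\<dots> \<le> 2 ^ N" using i by (intro power_increasing) auto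
    finally have c: "real (i choose j) \<le> 2 ^ N" .
    have "norm x ^ (i - j) \<le> \<rho> ^ (i - j)" using x by (intro power_mono) auto
    also have "\<dots> \<le> \<rho> ^ N" using i x by (intro power_increasing) auto
    finally have "norm x ^ (i - j) \<le> \<rho> ^ N" .
    then show "norm (coeff p i * of_nat (i choose j) * x ^ (i - j)) \<le> H * 2 ^ N * \<rho> ^ N"
      unfolding norm_mult norm_power norm_of_nat
      using c p(2)[of i] H x by (intro mult_mono) auto
  qed
  also have "\<dots> = real (N + 1) * (2 ^ N * \<rho> ^ N * H)" by (simp add: algebra_simps)
  also have "\<dots> \<le> 2 ^ N * (2 ^ N * \<rho> ^ N * H)"
  proof (rule mult_right_mono)
    have "N + 1 \<le> 2 ^ N" using less_exp[of N] by (simp add: Suc_le_eq)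
    then show "real (N + 1) \<le> 2 ^ N" by (metis of_nat_le_iff of_nat_numeral of_nat_power)
  qed (use H x in auto)
  also have "\<dots> = (2 * 2) ^ N * \<rho> ^ N * H"
    unfolding power_mult_distrib by (simp only: mult_ac)
  finally show ?thesis by simp
qed

text \<open>The polynomial is first expanded at \<alpha>, where only terms of order at least
  \<open>M\<close> survive, and then moved by \<open>x - \<alpha>\<close>. Of the base 16, a factor
  4 comes from the first shift, and a factor 2 each from the binomials and the number of
  terms.\<close>

lemma norm_coeff_shift_near_root_le:
  fixes p :: "complex poly"
  assumes p: "degree p \<le> N" "\<And>i. norm (coeff p i) \<le> H" and dvd: "[:- \<alpha>, 1:] ^ M dvd p"
    and \<rho>: "norm \<alpha> \<le> \<rho>" "1 \<le> \<rho>" and x: "norm (x - \<alpha>) \<le> 1" and j: "j \<le> M"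
  shows "norm (coeff (p \<circ>\<^sub>p [:x, 1:]) j) \<le> 16 ^ N * \<rho> ^ N * H * norm (x - \<alpha>) ^ (M - j)"
proof -
  define g where "g = p \<circ>\<^sub>p [:\<alpha>, 1:]"
  define h where "h = norm (x - \<alpha>)"
  have g: "norm (coeff g i) \<le> 4 ^ N * \<rho> ^ N * H" for i
    unfolding g_def by (rule norm_coeff_shift_le[OF p \<rho>])
  have g0: "coeff g i = 0" if "i < M" for i
    using dvd that unfolding linear_power_dvd_iff_coeff_shift g_def by blast
  have dg: "degree g \<le> N" using p(1) degree_pcompose_le[of p "[:\<alpha>, 1:]"] by (simp add: g_def)
  have G: "0 \<le> 4 ^ N * \<rho> ^ N * H" using g[of 0] norm_ge_zero order_trans by blast
  have h: "0 \<le> h" "h \<le> 1" using x by (auto simp: h_def)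
  have "p \<circ>\<^sub>p [:x, 1:] = g \<circ>\<^sub>p [:x - \<alpha>, 1:]" unfolding g_def pcompose_shift_shift by simp
  then have "norm (coeff (p \<circ>\<^sub>p [:x, 1:]) j)
      \<le> (\<Sum>i\<le>N. norm (coeff g i * of_nat (i choose j) * (x - \<alpha>) ^ (i - j)))"
    unfolding coeff_pcompose_shift[OF dg] by (simp add: coeff_pcompose_shift[OF dg] norm_sum)
  also have "\<dots> \<le> (\<Sum>i\<le>N. (4 ^ N * \<rho> ^ N * H) * 2 ^ N * h ^ (M - j))"
  proof (rule sum_mono)
    fix i assume i: "i \<in> {..N}"
    show "norm (coeff g i * of_nat (i choose j) * (x - \<alpha>) ^ (i - j))
      \<le> (4 ^ N * \<rho> ^ N * H) * 2 ^ N * h ^ (M - j)"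
    proof (cases "i < M")
      case True
      then show ?thesis using g0 G h by simp
    next
      case False
      have "real (i choose j) \<le> 2 ^ i" using binomial_le_pow2[of i j] by (metis of_nat_le_iff of_nat_numeral of_nat_power)
      also have "\<dots> \<le> 2 ^ N" using i by (intro power_increasing) auto
      finally have c: "real (i choose j) \<le> 2 ^ N" .
      have "h ^ (i - j) \<le> h ^ (M - j)" using h False by (intro power_decreasing) auto
      then show ?thesis
        unfolding norm_mult norm_power norm_of_nat h_def[symmetric]
        using c g[of i] G h by (intro mult_mono) auto
    qed
  qed
  also have "\<dots> = real (N + 1) * (4 ^ N * \<rho> ^ N * H * 2 ^ N * h ^ (M - j))" by simp
  also have "\<dots> \<le> 2 ^ N * (4 ^ N * \<rho> ^ N * H * 2 ^ N * h ^ (M - j))"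
  proof (rule mult_right_mono)
    have "N + 1 \<le> 2 ^ N" using less_exp[of N] by (simp add: Suc_le_eq)
    then show "real (N + 1) \<le> 2 ^ N" by (metis of_nat_le_iff of_nat_numeral of_nat_power)
  qed (use G h in auto)
  also have "\<dots> = (2 * 4 * 2) ^ N * \<rho> ^ N * H * h ^ (M - j)"
    unfolding power_mult_distrib by (simp only: mult_ac)
  finally show ?thesis unfolding h_def by simp
qed

section \<open>Wronskians and multiplicities over the rationals\<close>

definition rat_coeffs :: "complex poly \<Rightarrow> bool" where
  "rat_coeffs p \<longleftrightarrow> (\<forall>i. coeff p i \<in> \<rat>)"

lemma rat_coeffs_intros:
  assumes "rat_coeffs p" "rat_coeffs q"
  shows "rat_coeffs (p * q)" "rat_coeffs (p + q)" "rat_coeffs (p - q)"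
proof -
  have p: "coeff p i \<in> \<rat>" and q: "coeff q i \<in> \<rat>" for i
    using assms by (simp_all add: rat_coeffs_def)
  show "rat_coeffs (p * q)"
    unfolding rat_coeffs_def coeff_mult by (intro allI Rats_sum Rats_mult p q)
  show "rat_coeffs (p + q)" "rat_coeffs (p - q)"
    unfolding rat_coeffs_def coeff_add coeff_diff by (intro allI Rats_add Rats_diff p q)+
qed

lemma rat_coeffs_pderiv: "rat_coeffs p \<Longrightarrow> rat_coeffs (pderiv p)"
  unfolding rat_coeffs_def coeff_pderiv by (intro allI Rats_mult Rats_of_nat) simp

lemma linear_power_dvd_pderiv:
  fixes p :: "complex poly"
  assumes "[:- x, 1:] ^ J dvd p"
  shows "[:- x, 1:] ^ (J - 1) dvd pderiv p"
proof (cases J)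
  case (Suc i)
  then obtain q where q: "p = [:- x, 1:] ^ Suc i * q" using assms by blast
  have "pderiv p = [:- x, 1:] ^ i * ([:- x, 1:] * pderiv q + smult (of_nat (Suc i)) q)"
    unfolding q pderiv_mult pderiv_power_Suc by (simp add: pderiv_pCons algebra_simps)
  then show ?thesis using Suc by (metis diff_Suc_1 dvd_triv_left)
qed simp

text \<open>The Wronskian of \<open>A\<close> and \<open>B\<close> equals that of
  \<open>A - y*B\<close> and \<open>B\<close> for every \<open>y\<close>. Vanishing at different
  points with different multipliers is thereby collected in one polynomial.\<close>

lemma linear_power_dvd_wronskian:
  fixes A B :: "complex poly"
  assumes "[:- x, 1:] ^ J dvd A - smult y B"
  shows "[:- x, 1:] ^ (J - 1) dvd A * pderiv B - pderiv A * B"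
proof -
  define G where "G = A - smult y B"
  have "[:- x, 1:] ^ (J - 1) dvd G"
    using assms unfolding G_def by (meson diff_le_self dvd_trans le_imp_power_dvd)
  moreover have "[:- x, 1:] ^ (J - 1) dvd pderiv G"
    using assms unfolding G_def by (rule linear_power_dvd_pderiv)
  ultimately have "[:- x, 1:] ^ (J - 1) dvd G * pderiv B - pderiv G * B"
    by (intro dvd_diff dvd_mult2)
  also have "G * pderiv B - pderiv G * B = A * pderiv B - pderiv A * B"
    by (simp add: G_def pderiv_diff pderiv_smult algebra_simps)
  finally show ?thesis .
qed

text \<open>A multiple of \<open>B\<close> is subtracted so that the coefficient at
  \<open>degree B\<close> vanishes. A nonzero difference \<open>D\<close> has another degree,
  contradicting the leading coefficients in \<open>D*B' = D'*B\<close>.\<close>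

lemma wronskian_zero_imp_proportional:
  fixes A B :: "complex poly"
  assumes W: "A * pderiv B - pderiv A * B = 0" and B: "B \<noteq> 0"
  shows "A = smult (coeff A (degree B) / lead_coeff B) B"
proof -
  define c where "c = coeff A (degree B) / lead_coeff B"
  define D where "D = A - smult c B"
  have "D * pderiv B - pderiv D * B = 0"
    using W by (simp add: D_def pderiv_diff pderiv_smult algebra_simps)
  then have DB: "D * pderiv B = pderiv D * B" by simp
  have "D = 0"
  proof (rule ccontr)
    assume D: "D \<noteq> 0"
    have ne: "degree D \<noteq> degree B"
    proof
      assume "degree D = degree B"
      then have "coeff D (degree B) \<noteq> 0" using D by (metis leading_coeff_0_iff)
      then show False using B by (simp add: D_def c_def)
    qed
    have lc: "lead_coeff (pderiv p) = of_nat (degree p) * lead_coeff p" for p :: "complex poly"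
      by (cases "degree p") (auto simp: degree_pderiv coeff_pderiv coeff_eq_0)
    have "lead_coeff (D * pderiv B) = lead_coeff (pderiv D * B)" using DB by simp
    then have "of_nat (degree B) * (lead_coeff D * lead_coeff B)
        = of_nat (degree D) * (lead_coeff D * lead_coeff B)"
      unfolding lead_coeff_mult lc by (simp add: mult_ac)
    then show False using D B ne by simp
  qed
  then show ?thesis by (simp add: D_def c_def)
qed

text \<open>This is division by the monic polynomial \<open>f\<close> over the rationals: each step
  removes the leading term, and a remainder of degree below 3 vanishes by independence of the powers
  of \<alpha>.\<close>

lemma rat_coeffs_cubic_dvd:
  fixes a b c :: rat and \<alpha> :: complex
  defines "f \<equiv> [:of_rat c, of_rat b, of_rat a, 1:]"
  assumes root: "\<alpha>^3 + of_rat a * \<alpha>^2 + of_rat b * \<alpha> + of_rat c = 0"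
    and noroot: "\<And>t :: rat. t^3 + a * t^2 + b * t + c \<noteq> 0"
    and p: "rat_coeffs p" "poly p \<alpha> = 0"
  shows "\<exists>s. rat_coeffs s \<and> p = f * s"
  using p
proof (induction "degree p" arbitrary: p rule: less_induct)
  case less
  have fc: "rat_coeffs f"
    unfolding f_def rat_coeffs_def coeff_pCons by (auto split: nat.splits)
  have f\<alpha>: "poly f \<alpha> = 0"
    using root unfolding f_def by (simp add: algebra_simps power2_eq_square power3_eq_cube)
  have df: "degree f = 3" "lead_coeff f = 1" unfolding f_def by simp_all
  show ?case
  proof (cases "degree p < 3")
    case True
    define u v w where "u = coeff p 0" and "v = coeff p 1" and "w = coeff p 2"
    have "u \<in> \<rat>" "v \<in> \<rat>" "w \<in> \<rat>"
      using less.prems(1) unfolding rat_coeffs_def u_def v_def w_def by blast+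
    then obtain u' v' w' :: rat where uvw: "u = of_rat u'" "v = of_rat v'" "w = of_rat w'"
      by (metis Rats_cases)
    have "degree p \<le> 2" using True by simp
    from poly_altdef[of p] have "poly p \<alpha> = (\<Sum>i\<le>2. coeff p i * \<alpha> ^ i)"
      by (simp only:) (intro sum.mono_neutral_left; use \<open>degree p \<le> 2\<close> in \<open>auto simp: coeff_eq_0\<close>)
    also have "\<dots> = u + v * \<alpha> + w * \<alpha>^2"
      by (simp add: u_def v_def w_def eval_nat_numeral)
    finally have "of_rat u' + of_rat v' * \<alpha> + of_rat w' * \<alpha>^2 = 0" using less.prems(2) uvw by simp
    then have "u' = 0 \<and> v' = 0 \<and> w' = 0" by (rule cubic_independent[OF root noroot])
    then have z: "coeff p 0 = 0" "coeff p 1 = 0" "coeff p 2 = 0" using uvw u_def v_def w_def by auto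
    have "p = 0"
    proof (rule poly_eqI)
      fix i :: nat
      consider "i = 0" | "i = 1" | "i = 2" | "i > 2" by linarith
      then show "coeff p i = coeff 0 i"
        using z \<open>degree p \<le> 2\<close> by cases (simp_all add: coeff_eq_0)
    qed
    then show ?thesis by (intro exI[of _ 0]) (simp add: rat_coeffs_def)
  next
    case False
    define d where "d = degree p - 3"
    define m where "m = monom (lead_coeff p) d"
    have mc: "rat_coeffs m"
      using less.prems(1) unfolding m_def rat_coeffs_def by (simp add: coeff_monom)
    define q where "q = p - f * m"
    have qc: "rat_coeffs q" unfolding q_def by (intro rat_coeffs_intros less.prems fc mc)
    have q\<alpha>: "poly q \<alpha> = 0" using less.prems(2) f\<alpha> by (simp add: q_def)
    have p0: "p \<noteq> 0" using False by auto
    have m0: "m \<noteq> 0" using p0 by (simp add: m_def)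
    have f0: "f \<noteq> 0" using df by auto
    have dm: "degree m = d" "lead_coeff m = lead_coeff p" using p0 by (simp_all add: m_def degree_monom_eq)
    have dfm: "degree (f * m) = degree p" using f0 m0 df dm False by (simp add: degree_mult_eq d_def)
    have lfm: "lead_coeff (f * m) = lead_coeff p" using df dm by (simp add: lead_coeff_mult)
    have "degree q < degree p"
    proof (rule degree_lessI)
      show "q \<noteq> 0 \<or> degree p > 0" using False by simp
      show "\<forall>k\<ge>degree p. coeff q k = 0"
      proof (intro allI impI)
        fix k assume "degree p \<le> k"
        then show "coeff q k = 0"
          using dfm lfm by (cases "k = degree p") (simp_all add: q_def coeff_eq_0)
      qed
    qed
    then obtain s where s: "rat_coeffs s" "q = f * s" using less.hyps qc q\<alpha> by blast
    have "p = f * (m + s)" using s(2) by (simp add: q_def algebra_simps)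
    then show ?thesis using rat_coeffs_intros(2)[OF mc s(1)] by blast
  qed
qed

text \<open>Independence also shows that \<alpha> is a simple root of \<open>f\<close>, so each
  factor \<open>f\<close> uses up only one order of vanishing at \<alpha>.\<close>

lemma rat_coeffs_cubic_power_dvd:
  fixes a b c :: rat and \<alpha> :: complex
  defines "f \<equiv> [:of_rat c, of_rat b, of_rat a, 1:]"
  assumes root: "\<alpha>^3 + of_rat a * \<alpha>^2 + of_rat b * \<alpha> + of_rat c = 0"
    and noroot: "\<And>t :: rat. t^3 + a * t^2 + b * t + c \<noteq> 0"
    and p: "rat_coeffs p" "p \<noteq> 0" "[:- \<alpha>, 1:] ^ M dvd p"
  shows "\<exists>s. rat_coeffs s \<and> p = f ^ M * s"
  using p
proof (induction M arbitrary: p)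
  case 0
  then show ?case by auto
next
  case (Suc M)
  have "poly p \<alpha> = 0"
    using Suc.prems(3) by (metis dvd_iff_poly_eq_0 dvd_mult_left power_Suc minus_minus)
  then obtain s where s: "rat_coeffs s" "p = f * s"
    using rat_coeffs_cubic_dvd[OF root noroot Suc.prems(1)] unfolding f_def by blast
  have simple: "poly (pderiv f) \<alpha> \<noteq> 0"
  proof
    assume "poly (pderiv f) \<alpha> = 0"
    then have "of_rat b + of_rat (2 * a) * \<alpha> + of_rat 3 * \<alpha>^2 = 0"
      unfolding f_def by (simp add: pderiv_pCons of_rat_mult algebra_simps power2_eq_square)
    then have "(3::rat) = 0" using cubic_independent[OF root noroot] by blast
    then show False by simp
  qed
  have fs: "f \<noteq> 0" "s \<noteq> 0" using Suc.prems(2) s by auto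
  have f1: "Polynomial.order \<alpha> f \<le> 1"
  proof (rule ccontr)
    assume "\<not> ?thesis"
    then have "[:- \<alpha>, 1:] ^ 2 dvd f" using fs by (simp add: order_divides)
    from linear_power_dvd_pderiv[OF this] have "[:- \<alpha>, 1:] dvd pderiv f" by simp
    then show False using simple by (metis dvd_iff_poly_eq_0 minus_minus)
  qed
  have "Suc M \<le> Polynomial.order \<alpha> (f * s)"
    using Suc.prems(2,3) s(2) order_divides[of \<alpha> "Suc M" p] by metis
  then have "M \<le> Polynomial.order \<alpha> s" using f1 fs by (simp add: order_mult)
  then have "[:- \<alpha>, 1:] ^ M dvd s" by (simp add: order_divides)
  then obtain t where "rat_coeffs t" "s = f ^ M * t" using Suc.IH[OF s(1) fs(2)] by blast
  then show ?case using s(2) by (intro exI[of _ t]) (simp add: mult_ac)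
qed

text \<open>The Wronskian has rational coefficients, so it is divisible by \<open>f^(M - 1)\<close>;
  it also vanishes to order \<open>J - 1\<close> at the rational point, where \<open>f\<close> does
  not. Its degree is at most \<open>2*N - 1\<close>, hence the bound. It is nonzero, since otherwise
  \<open>A\<close> or \<open>B\<close> would be a nonzero rational polynomial divisible by
  \<open>f^M\<close>, of degree \<open>3*M > N\<close>.\<close>

lemma thue_vanishing_order_le:
  fixes a b c :: rat and \<alpha> :: complex and A B :: "complex poly"
  assumes root: "\<alpha>^3 + of_rat a * \<alpha>^2 + of_rat b * \<alpha> + of_rat c = 0"
    and noroot: "\<And>t :: rat. t^3 + a * t^2 + b * t + c \<noteq> 0"
    and rat: "rat_coeffs A" "rat_coeffs B" and deg: "degree A \<le> N" "degree B \<le> N"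
    and nz: "A \<noteq> 0 \<or> B \<noteq> 0" and \<alpha>: "[:- \<alpha>, 1:] ^ M dvd A - smult \<alpha> B" and M: "N < 3 * M" "1 \<le> M" "1 \<le> N"
    and x: "[:- of_rat x, 1:] ^ J dvd A - smult y B"
  shows "J + 3 * M \<le> 2 * N + 3"
proof -
  define f :: "complex poly" where "f = [:of_rat c, of_rat b, of_rat a, 1:]"
  define W where "W = A * pderiv B - pderiv A * B"
  have df: "degree f = 3" unfolding f_def by simp
  then have f0: "f \<noteq> 0" by auto
  have fx: "poly f (of_rat x) \<noteq> 0"
  proof
    assume "poly f (of_rat x) = 0"
    then have "of_rat (x^3 + a * x^2 + b * x + c) = (0 :: complex)"
      unfolding f_def of_rat_add of_rat_mult of_rat_power
      by (simp add: algebra_simps power2_eq_square power3_eq_cube)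
    then show False using noroot[of x] by simp
  qed
  have small: False if p: "rat_coeffs p" "p \<noteq> 0" "[:- \<alpha>, 1:] ^ M dvd p" "degree p \<le> N" for p
  proof -
    obtain s where s: "p = f ^ M * s"
      using rat_coeffs_cubic_power_dvd[OF root noroot p(1-3)] unfolding f_def by blast
    then have "degree p = 3 * M + degree s"
      using p(2) f0 df by (simp add: degree_mult_eq degree_power_eq mult.commute)
    then show False using p(4) M(1) by simp
  qed
  have irr: "\<alpha> \<notin> \<rat>"
  proof
    assume "\<alpha> \<in> \<rat>"
    then obtain t where "\<alpha> = of_rat t" by (auto elim: Rats_cases)
    then have "of_rat (t^3 + a * t^2 + b * t + c) = (0::complex)"
      using root by (simp add: of_rat_add of_rat_mult of_rat_power)
    then show False using noroot[of t] by simp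
  qed
  have W0: "W \<noteq> 0"
  proof
    assume W: "W = 0"
    show False
    proof (cases "B = 0")
      case True
      then show False using small[of A] nz \<alpha> rat deg by simp
    next
      case False
      define e where "e = coeff A (degree B) / lead_coeff B"
      have e: "e \<in> \<rat>" using rat unfolding e_def rat_coeffs_def by (intro Rats_divide) auto
      have "A = smult e B"
        unfolding e_def using W False unfolding W_def by (rule wronskian_zero_imp_proportional)
      then have "A - smult \<alpha> B = smult (e - \<alpha>) B" by (simp add: smult_diff_left)
      moreover have "e - \<alpha> \<noteq> 0" using e irr by auto
      ultimately have "[:- \<alpha>, 1:] ^ M dvd B" using \<alpha> by (simp add: dvd_smult_iff)
      then show False using small[of B] False rat deg by blast
    qed
  qed
  have Wc: "rat_coeffs W" unfolding W_def by (intro rat_coeffs_intros rat_coeffs_pderiv rat)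
  have "[:- \<alpha>, 1:] ^ (M - 1) dvd W" unfolding W_def by (rule linear_power_dvd_wronskian[OF \<alpha>])
  then obtain s where s: "W = f ^ (M - 1) * s"
    using rat_coeffs_cubic_power_dvd[OF root noroot Wc W0] unfolding f_def by blast
  have s0: "s \<noteq> 0" using W0 s by auto
  have dW: "degree W = 3 * (M - 1) + degree s"
    using s s0 f0 df by (simp add: degree_mult_eq degree_power_eq mult.commute)
  have "[:- of_rat x, 1:] ^ (J - 1) dvd W" unfolding W_def by (rule linear_power_dvd_wronskian[OF x])
  then have "J - 1 \<le> Polynomial.order (of_rat x) W" using W0 by (simp add: order_divides)
  also have "\<dots> = Polynomial.order (of_rat x) (f ^ (M - 1)) + Polynomial.order (of_rat x) s"
    using W0 unfolding s by (rule order_mult)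
  also have "Polynomial.order (of_rat x) (f ^ (M - 1)) = 0"
    by (rule order_0I) (use fx in simp)
  also have "0 + Polynomial.order (of_rat x) s \<le> degree s" using order_degree[OF s0] by simp
  finally have J: "J - 1 \<le> degree s" .
  have "degree W \<le> 2 * N - 1"
  proof -
    have "degree (A * pderiv B) \<le> 2 * N - 1"
      using degree_mult_le[of A "pderiv B"] degree_pderiv[of B] deg M(3) by linarith
    moreover have "degree (pderiv A * B) \<le> 2 * N - 1"
      using degree_mult_le[of "pderiv A" B] degree_pderiv[of A] deg M(3) by linarith
    ultimately show ?thesis unfolding W_def by (rule degree_diff_le)
  qed
  then show ?thesis using J dW M by linarith
qed

section \<open>Construction of the auxiliary polynomials\<close>

lemma cubic_power_reduction:
  fixes a b c :: int and \<alpha> :: complex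
  assumes root: "\<alpha>^3 + of_int a * \<alpha>^2 + of_int b * \<alpha> + of_int c = 0"
  defines "K \<equiv> nat (1 + \<bar>a\<bar> + \<bar>b\<bar> + \<bar>c\<bar>)"
  obtains \<rho> :: "nat \<Rightarrow> nat \<Rightarrow> int" where
    "\<And>i. \<alpha>^i = (\<Sum>l<3. of_int (\<rho> i l) * \<alpha>^l)" "\<And>i l. \<bar>\<rho> i l\<bar> \<le> int (K ^ i)"
proof -
  have K: "int K = 1 + \<bar>a\<bar> + \<bar>b\<bar> + \<bar>c\<bar>" by (simp add: K_def)
  have "\<exists>r. \<alpha>^i = (\<Sum>l<3. of_int (r l) * \<alpha>^l) \<and> (\<forall>l. \<bar>r l\<bar> \<le> int (K ^ i))" for i
  proof (induction i)
    case 0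
    show ?case
      by (rule exI[of _ "\<lambda>l. if l = 0 then 1 else 0"]) (simp add: eval_nat_numeral)
  next
    case (Suc i)
    then obtain r where r: "\<alpha>^i = (\<Sum>l<3. of_int (r l) * \<alpha>^l)" "\<And>l. \<bar>r l\<bar> \<le> int (K ^ i)" by blast
    \<comment> \<open>Coordinates after multiplying by \<alpha> and substituting for \<alpha> cubed.
      Each is bounded by \<open>K\<close> times the previous bound.\<close>
    define r' where "r' = (\<lambda>l::nat. if l = 0 then - c * r 2 else if l = 1 then r 0 - b * r 2
      else if l = 2 then r 1 - a * r 2 else 0)"
    have "\<alpha>^Suc i = of_int (r 0) * \<alpha> + of_int (r 1) * \<alpha>^2 + of_int (r 2) * \<alpha>^3"
      using r(1) by (simp add: eval_nat_numeral algebra_simps)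
    also have "\<alpha>^3 = - of_int a * \<alpha>^2 - of_int b * \<alpha> - of_int c"
      using root by (simp add: algebra_simps eq_neg_iff_add_eq_0)
    finally have e1: "\<alpha>^Suc i = (\<Sum>l<3. of_int (r' l) * \<alpha>^l)"
      by (simp add: r'_def eval_nat_numeral algebra_simps)
    have e2: "\<bar>r' l\<bar> \<le> int (K ^ Suc i)" for l
    proof -
      define R where "R = int (K ^ i)"
      have R: "\<bar>r l\<bar> \<le> R" for l using r(2) R_def by simp
      then have R0: "0 \<le> R" using abs_ge_zero order_trans by blast
      have KR: "int (K ^ Suc i) = R + \<bar>a\<bar> * R + \<bar>b\<bar> * R + \<bar>c\<bar> * R"
        using K by (simp add: R_def algebra_simps)
      have "0 \<le> \<bar>a\<bar> * R" "0 \<le> \<bar>b\<bar> * R" "0 \<le> \<bar>c\<bar> * R" using R0 by simp_all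
      moreover have "\<bar>a * r 2\<bar> \<le> \<bar>a\<bar> * R" "\<bar>b * r 2\<bar> \<le> \<bar>b\<bar> * R" "\<bar>c * r 2\<bar> \<le> \<bar>c\<bar> * R"
        using R[of 2] by (simp_all add: abs_mult mult_left_mono)
      moreover have "\<bar>r 0 - b * r 2\<bar> \<le> \<bar>r 0\<bar> + \<bar>b * r 2\<bar>" "\<bar>r 1 - a * r 2\<bar> \<le> \<bar>r 1\<bar> + \<bar>a * r 2\<bar>"
        by (rule abs_triangle_ineq4)+
      moreover have "r' l = - (c * r 2) \<or> r' l = r 0 - b * r 2 \<or> r' l = r 1 - a * r 2 \<or> r' l = 0"
        by (simp add: r'_def)
      ultimately show ?thesis
        unfolding KR using R[of 0] R[of 1] R0 by (elim disjE) (simp only: abs_minus_cancel abs_zero; linarith)+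
    qed
    show ?case by (rule exI[of _ r'], rule conjI[OF e1], rule allI, rule e2)
  qed
  then obtain \<rho> where \<rho>: "\<And>i. \<alpha>^i = (\<Sum>l<3. of_int (\<rho> i l) * \<alpha>^l) \<and> (\<forall>l. \<bar>\<rho> i l\<bar> \<le> int (K ^ i))"
    by metis
  show thesis by (rule that[of \<rho>, OF conjunct1[OF \<rho>] spec[OF conjunct2[OF \<rho>]]])
qed

text \<open>The vanishing conditions, written in the basis \<open>1, \<alpha>, \<alpha>\<^sup>2\<close>, are \<open>3 * 20k\<close> integer equations in
  the \<open>2(31k + 1)\<close> unknown coefficients.\<close>

lemma thue_auxiliary_polynomials:
  fixes a b c :: int and \<alpha> :: complex
  assumes root: "\<alpha>^3 + of_int a * \<alpha>^2 + of_int b * \<alpha> + of_int c = 0"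
  obtains E :: real where "1 \<le> E"
    "\<And>k. 1 \<le> k \<Longrightarrow> \<exists>A B :: complex poly. (\<forall>i. coeff A i \<in> \<int> \<and> coeff B i \<in> \<int>) \<and>
       (\<forall>i. norm (coeff A i) \<le> E ^ k \<and> norm (coeff B i) \<le> E ^ k) \<and>
       degree A \<le> 31 * k \<and> degree B \<le> 31 * k \<and> (A \<noteq> 0 \<or> B \<noteq> 0) \<and>
       [:- \<alpha>, 1:] ^ (20 * k) dvd A - smult \<alpha> B"
proof -
  define c0 where "c0 = nat (1 + \<bar>a\<bar> + \<bar>b\<bar> + \<bar>c\<bar>)"
  have c0: "1 \<le> c0" by (simp add: c0_def)
  obtain \<rho> :: "nat \<Rightarrow> nat \<Rightarrow> int" where
    \<rho>: "\<And>i. \<alpha>^i = (\<Sum>l<3. of_int (\<rho> i l) * \<alpha>^l)" "\<And>i l. \<bar>\<rho> i l\<bar> \<le> int (c0 ^ i)"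
    using cubic_power_reduction[OF root] unfolding c0_def by blast
  \<comment> \<open>The base bounds the k-th root of \<open>T\<close> below; the solution size is
    less than \<open>T^30\<close>, whence the outer exponent 30.\<close>
  define E :: nat where "E = (128 * 2 * 2 ^ 31 * c0 ^ 32) ^ 30"
  have "0 < E" unfolding E_def using c0 by (intro zero_less_power) simp
  then have E: "1 \<le> real E" by simp
  have "\<exists>A B :: complex poly. (\<forall>i. coeff A i \<in> \<int> \<and> coeff B i \<in> \<int>) \<and>
       (\<forall>i. norm (coeff A i) \<le> real E ^ k \<and> norm (coeff B i) \<le> real E ^ k) \<and>
       degree A \<le> 31 * k \<and> degree B \<le> 31 * k \<and> (A \<noteq> 0 \<or> B \<noteq> 0) \<and>
       [:- \<alpha>, 1:] ^ (20 * k) dvd A - smult \<alpha> B" if k: "1 \<le> k" for k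
  proof -
    define N where "N = 31 * k"
    define K where "K = 2 ^ N * c0 ^ (N + 1)"
    define s where "s = 2 * (N + 1)"
    define r where "r = 60 * k"
    define T where "T = 2 * s * K"
    \<comment> \<open>There are \<open>60*k\<close> equations in \<open>62*k + 2\<close> unknowns.
      With \<open>H + 1 = T^30\<close> the loss \<open>T^(60*k)\<close> is exactly
      \<open>(H + 1)^(2*k)\<close>, so the pigeonhole count becomes
      \<open>62*k < 62*k + 2\<close>.\<close>
    define H where "H = T ^ 30 - 1"
    \<comment> \<open>Row \<open>e = 3*j + l\<close> is the coordinate \<open>l\<close> of the j-th
      Taylor coefficient at \<alpha>. Columns up to \<open>N\<close> belong to \<open>A\<close>; the
      later ones to \<open>B\<close>, where the multiplier -\<alpha> raises the exponent by
      one.\<close>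
    define g where "g = (\<lambda>e n. if n \<le> N then int (n choose (e div 3)) * \<rho> (n - e div 3) (e mod 3)
      else - int ((n - (N + 1)) choose (e div 3)) * \<rho> (n - (N + 1) - e div 3 + 1) (e mod 3))"
    have K1: "1 \<le> K" using c0 by (simp add: K_def)
    have s1: "1 \<le> s" by (simp add: s_def)
    have T2: "2 \<le> T" unfolding T_def using K1 s1 by (metis mult.assoc mult_le_mono mult_1_right order_refl)
    have HT: "H + 1 = T ^ 30" using T2 by (simp add: H_def)
    have H1: "2 \<le> H + 1" unfolding HT using T2 self_le_power[of T 30] by linarith
    have g: "\<bar>g e n\<bar> \<le> int K" if "n < s" for e n
    proof -
      have ch: "int (i choose j) \<le> 2 ^ N" if "i \<le> N" for i j
      proof -
        have "i choose j \<le> 2 ^ i" by (rule binomial_le_pow2)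
        also have "\<dots> \<le> 2 ^ N" using that by (intro power_increasing) auto
        finally show ?thesis by (metis of_nat_le_iff of_nat_numeral of_nat_power)
      qed
      have rh: "\<bar>\<rho> i l\<bar> \<le> int (c0 ^ (N + 1))" if "i \<le> N + 1" for i l
      proof -
        have "c0 ^ i \<le> c0 ^ (N + 1)" using c0 that by (intro power_increasing) auto
        then show ?thesis using \<rho>(2)[of i l] by linarith
      qed
      have "\<bar>g e n\<bar> \<le> 2 ^ N * int (c0 ^ (N + 1))"
      proof (cases "n \<le> N")
        case True
        then have "\<bar>g e n\<bar> = int (n choose (e div 3)) * \<bar>\<rho> (n - e div 3) (e mod 3)\<bar>"
          by (simp add: g_def abs_mult)
        also have "\<dots> \<le> 2 ^ N * int (c0 ^ (N + 1))"
          by (intro mult_mono ch rh) (use True in auto)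
        finally show ?thesis .
      next
        case False
        then have "\<bar>g e n\<bar> = int ((n - (N + 1)) choose (e div 3)) * \<bar>\<rho> (n - (N + 1) - e div 3 + 1) (e mod 3)\<bar>"
          by (simp add: g_def abs_mult)
        also have "\<dots> \<le> 2 ^ N * int (c0 ^ (N + 1))"
          by (intro mult_mono ch rh) (use \<open>n < s\<close> in \<open>auto simp: s_def\<close>)
        finally show ?thesis .
      qed
      then show ?thesis by (simp add: K_def)
    qed
    have count: "(2*s*K*H + 1) ^ r < (H + 1) ^ s"
    proof -
      have "2*s*K*H + 1 \<le> T * (H + 1)" using T2 by (simp add: T_def)
      then have "(2*s*K*H + 1) ^ r \<le> (T * (H + 1)) ^ r" by (rule power_mono) simp
      also have "\<dots> = (T ^ 30) ^ (2 * k) * (H + 1) ^ (60 * k)"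
        unfolding r_def power_mult_distrib by (simp flip: power_mult)
      also have "\<dots> = (H + 1) ^ (62 * k)" unfolding HT[symmetric] by (simp flip: power_add)
      also have "\<dots> < (H + 1) ^ s"
        by (rule power_strict_increasing) (use H1 in \<open>auto simp: s_def N_def\<close>)
      finally show ?thesis .
    qed
    obtain x where x: "\<exists>j<s. x j \<noteq> 0" "\<And>j. j < s \<Longrightarrow> \<bar>x j\<bar> \<le> int H"
      "\<And>e. e < r \<Longrightarrow> (\<Sum>n<s. g e n * x n) = 0"
      using siegel_pigeonhole[of r s g K H] g count by blast
    define A B :: "complex poly" where "A = (\<Sum>i\<le>N. monom (of_int (x i)) i)"
      and "B = (\<Sum>i\<le>N. monom (of_int (x (N + 1 + i))) i)"
    have cA: "coeff A i = (if i \<le> N then of_int (x i) else 0)"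
      and cB: "coeff B i = (if i \<le> N then of_int (x (N + 1 + i)) else 0)" for i
      unfolding A_def B_def coeff_sum coeff_monom by (simp_all add: if_distrib if_distribR cong: if_cong)
    have dA: "degree A \<le> N" and dB: "degree B \<le> N"
      by (rule degree_le; simp add: cA cB)+
    have nz: "A \<noteq> 0 \<or> B \<noteq> 0"
    proof -
      obtain n where n: "n < s" "x n \<noteq> 0" using x(1) by blast
      show ?thesis
      proof (cases "n \<le> N")
        case True
        then have "coeff A n \<noteq> 0" using n by (simp add: cA)
        then show ?thesis by auto
      next
        case False
        then have "coeff B (n - (N + 1)) \<noteq> 0" using n by (simp add: cB s_def)
        then show ?thesis by auto
      qed
    qed
    have "real H \<le> real (T ^ 30)" unfolding of_nat_le_iff by (simp add: H_def)
    also have "T ^ 30 \<le> E ^ k"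
    proof -
      have "T = 2 * (62 * k + 2) * (2 ^ (31 * k) * c0 ^ (31 * k + 1))"
        by (simp add: T_def s_def K_def N_def)
      also have "\<dots> \<le> (128 * 2 ^ k) * (2 ^ (31 * k) * c0 ^ (32 * k))"
      proof (rule mult_mono)
        have "2 * (62 * k + 2) \<le> 128 * k" using k by simp
        also have "\<dots> \<le> 128 * 2 ^ k" using less_imp_le[OF less_exp[of k]] by (rule mult_left_mono) simp
        finally show "2 * (62 * k + 2) \<le> 128 * 2 ^ k" .
        show "2 ^ (31 * k) * c0 ^ (31 * k + 1) \<le> 2 ^ (31 * k) * c0 ^ (32 * k)"
          using c0 k by (intro mult_left_mono power_increasing) auto
      qed auto
      also have "\<dots> \<le> (128 ^ k * 2 ^ k) * (2 ^ (31 * k) * c0 ^ (32 * k))"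
        using k self_le_power[of 128 k] by (intro mult_mono) auto
      also have "\<dots> = (128 * 2 * 2 ^ 31 * c0 ^ 32) ^ k"
        by (simp only: power_mult_distrib power_mult[symmetric] mult.assoc mult.commute mult.left_commute)
      finally have "T ^ 30 \<le> ((128 * 2 * 2 ^ 31 * c0 ^ 32) ^ k) ^ 30" by (rule power_mono) simp
      also have "\<dots> = E ^ k" unfolding E_def power_mult[symmetric] by (simp only: mult.commute)
      finally show ?thesis .
    qed
    finally have HE: "real H \<le> real E ^ k" by simp
    have xE: "norm (of_int (x n) :: complex) \<le> real E ^ k" if "n < s" for n
    proof -
      have "norm (of_int (x n) :: complex) = of_int \<bar>x n\<bar>" by simp
      also have "\<dots> \<le> real H" using x(2)[OF that] by linarith
      finally show ?thesis using HE by linarith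
    qed
    have bd: "norm (coeff A i) \<le> real E ^ k" "norm (coeff B i) \<le> real E ^ k" for i
      using xE[of i] xE[of "N + 1 + i"] E by (auto simp: cA cB s_def)
    have dvd: "[:- \<alpha>, 1:] ^ (20 * k) dvd A - smult \<alpha> B"
      unfolding linear_power_dvd_iff_coeff_shift
    proof (intro allI impI)
      fix j assume j: "j < 20 * k"
      have eq: "(\<Sum>i\<le>N. of_int (g (3 * j + l) i) * of_int (x i))
          + (\<Sum>i\<le>N. of_int (g (3 * j + l) (N + 1 + i)) * of_int (x (N + 1 + i))) = (0 :: complex)"
        if l: "l < 3" for l
      proof -
        have "(\<Sum>n<s. g (3 * j + l) n * x n) = 0" by (rule x(3)) (use j l in \<open>simp add: r_def\<close>)
        moreover have "(\<Sum>n<s. g (3 * j + l) n * x n)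
          = (\<Sum>i\<le>N. g (3 * j + l) i * x i) + (\<Sum>i\<le>N. g (3 * j + l) (N + 1 + i) * x (N + 1 + i))"
        proof -
          have split: "(\<Sum>n<u + v. h n) = (\<Sum>n<u. h n) + (\<Sum>i<v. h (u + i))" for u v and h :: "nat \<Rightarrow> int"
            by (induction v) (simp_all add: add.assoc)
          have "s = (N + 1) + (N + 1)" by (simp add: s_def)
          then show ?thesis unfolding split[symmetric] lessThan_Suc_atMost[symmetric] Suc_eq_plus1
            by (simp only: split)
        qed
        ultimately have "of_int ((\<Sum>i\<le>N. g (3 * j + l) i * x i)
          + (\<Sum>i\<le>N. g (3 * j + l) (N + 1 + i) * x (N + 1 + i))) = (0 :: complex)" by simp
        then show ?thesis by simp
      qed
      have dj: "(3 * j + l) div 3 = j" "(3 * j + l) mod 3 = l" if "l < 3" for l using that by simp_all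
      have gA: "(\<Sum>l<3. of_int (g (3 * j + l) i) * \<alpha>^l) = of_nat (i choose j) * \<alpha>^(i - j)" if "i \<le> N" for i
      proof -
        have "(\<Sum>l<3. of_int (g (3 * j + l) i) * \<alpha>^l) = (\<Sum>l<3. of_nat (i choose j) * (of_int (\<rho> (i - j) l) * \<alpha>^l))"
          by (rule sum.cong) (use that in \<open>simp_all add: g_def dj\<close>)
        then show ?thesis by (simp add: \<rho>(1)[of "i - j"] sum_distrib_left)
      qed
      have gB: "(\<Sum>l<3. of_int (g (3 * j + l) (N + 1 + i)) * \<alpha>^l) = - of_nat (i choose j) * \<alpha>^(i - j + 1)" for i
      proof -
        have "(\<Sum>l<3. of_int (g (3 * j + l) (N + 1 + i)) * \<alpha>^l)
          = (\<Sum>l<3. - of_nat (i choose j) * (of_int (\<rho> (i - j + 1) l) * \<alpha>^l))"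
          by (rule sum.cong) (simp_all add: g_def dj)
        then show ?thesis unfolding \<rho>(1)[of "i - j + 1"] by (simp add: sum_distrib_left)
      qed
      have "coeff ((A - smult \<alpha> B) \<circ>\<^sub>p [:\<alpha>, 1:]) j
        = (\<Sum>i\<le>N. of_int (x i) * (of_nat (i choose j) * \<alpha>^(i - j)))
          + (\<Sum>i\<le>N. of_int (x (N + 1 + i)) * (- of_nat (i choose j) * \<alpha>^(i - j + 1)))"
        unfolding pcompose_diff pcompose_smult coeff_diff coeff_smult
          coeff_pcompose_shift[OF dA] coeff_pcompose_shift[OF dB]
        by (simp add: cA cB sum_distrib_left sum_negf mult_ac)
      also have "\<dots> = (\<Sum>i\<le>N. of_int (x i) * (\<Sum>l<3. of_int (g (3 * j + l) i) * \<alpha>^l))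
          + (\<Sum>i\<le>N. of_int (x (N + 1 + i)) * (\<Sum>l<3. of_int (g (3 * j + l) (N + 1 + i)) * \<alpha>^l))"
        unfolding gB by (simp add: gA)
      \<comment> \<open>Exchanging the sums collects the coordinates with respect to 1, \<alpha> and
        its square; each is one of the solved equations.\<close>
      also have "\<dots> = (\<Sum>l<3. ((\<Sum>i\<le>N. of_int (g (3 * j + l) i) * of_int (x i))
          + (\<Sum>i\<le>N. of_int (g (3 * j + l) (N + 1 + i)) * of_int (x (N + 1 + i)))) * \<alpha>^l)"
        unfolding distrib_right sum.distrib sum_distrib_left sum_distrib_right
        by (subst (1 3) sum.swap) (simp only: mult_ac)
      also have "\<dots> = 0" by (rule sum.neutral) (use eq in simp)
      finally show "coeff ((A - smult \<alpha> B) \<circ>\<^sub>p [:\<alpha>, 1:]) j = 0" .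
    qed
    have ints: "coeff A i \<in> \<int>" "coeff B i \<in> \<int>" for i by (simp_all add: cA cB)
    show ?thesis
      by (rule exI[of _ A], rule exI[of _ B]) (use ints bd dA dB nz dvd in \<open>simp add: N_def\<close>)
  qed
  then show thesis using that[of "real E"] E by blast
qed

section \<open>The gap between two good approximations\<close>

lemma Ints_norm_ge_1:
  fixes z :: complex
  assumes "z \<in> \<int>" "z \<noteq> 0"
  shows "1 \<le> norm z"
proof -
  obtain i where i: "z = of_int i" using assms(1) by (auto elim: Ints_cases)
  then have "1 \<le> \<bar>i\<bar>" using assms(2) by auto
  then have "1 \<le> real_of_int \<bar>i\<bar>" by linarith
  then show ?thesis by (simp add: i)
qed

text \<open>Only powers of \<open>p0/q0\<close> up to \<open>N\<close> occur, so \<open>q0^N\<close>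
  clears them, and \<open>q1\<close> clears the multiplier. A nonzero Taylor coefficient is
  therefore bounded below.\<close>

lemma coeff_shift_clear_denominators:
  fixes A B :: "complex poly" and p0 q0 p1 q1 :: int
  assumes "\<And>i. coeff A i \<in> \<int>" "\<And>i. coeff B i \<in> \<int>" "degree A \<le> N" "degree B \<le> N" "q0 > 0" "q1 > 0"
  shows "of_int q0 ^ N * of_int q1
    * coeff ((A - smult (of_int p1 / of_int q1) B) \<circ>\<^sub>p [:of_int p0 / of_int q0, 1:]) j \<in> \<int>"
proof -
  define x y :: complex where "x = of_int p0 / of_int q0" and "y = of_int p1 / of_int q1"
  have y: "of_int q1 * y = of_int p1" using assms(6) by (simp add: y_def)
  have x: "of_int q0 ^ N * x ^ (i - j) \<in> \<int>" if "i \<le> N" for i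
  proof -
    have "of_int q0 ^ N = (of_int q0 ^ (N - (i - j)) * of_int q0 ^ (i - j) :: complex)"
      using that by (simp flip: power_add)
    then have "of_int q0 ^ N * x ^ (i - j) = of_int q0 ^ (N - (i - j)) * (of_int p0 ^ (i - j) :: complex)"
      using assms(5) by (simp add: x_def power_divide)
    then show ?thesis by simp
  qed
  have "degree (A - smult y B) \<le> N" using assms(3,4) by (simp add: degree_diff_le)
  then have "of_int q0 ^ N * of_int q1 * coeff ((A - smult y B) \<circ>\<^sub>p [:x, 1:]) j
    = (\<Sum>i\<le>N. (of_int q1 * coeff A i - of_int q1 * y * coeff B i) * of_nat (i choose j) * (of_int q0 ^ N * x ^ (i - j)))"
    by (simp add: coeff_pcompose_shift sum_distrib_left algebra_simps)
  also have "\<dots> \<in> \<int>" unfolding y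
    by (intro Ints_sum Ints_mult Ints_diff assms x) auto
  finally show ?thesis unfolding x_def y_def .
qed

text \<open>The auxiliary polynomials with parameter \<open>k\<close> are evaluated at the two
  approximations, where \<open>k\<close> is tuned so that \<open>q1\<close> lies between
  \<open>q0^(16*k)\<close> and \<open>q0^(16*(k + 1))\<close>. Clearing denominators gives a nonzero
  integer, while the estimates make it smaller than 1.\<close>

lemma thue_gap:
  fixes a b c :: int and \<alpha> :: complex and C :: real
  assumes root: "\<alpha>^3 + of_int a * \<alpha>^2 + of_int b * \<alpha> + of_int c = 0"
    and noroot: "\<And>t :: rat. t^3 + of_int a * t^2 + of_int b * t + of_int c \<noteq> 0"
    and C: "1 \<le> C"
  obtains Q :: real where
    "\<And>p0 q0 p1 q1 :: int. q0 > 0 \<Longrightarrow> q1 > 0 \<Longrightarrow> Q \<le> of_int q0 \<Longrightarrow>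
       norm (\<alpha> - of_int p0 / of_int q0) \<le> C / of_int q0 ^ 3 \<Longrightarrow>
       norm (\<alpha> - of_int p1 / of_int q1) \<le> C / of_int q1 ^ 3 \<Longrightarrow> q1 \<le> q0 ^ 80"
proof -
  obtain E :: real where E: "1 \<le> E" and aux:
    "\<And>k. 1 \<le> k \<Longrightarrow> \<exists>A B :: complex poly. (\<forall>i. coeff A i \<in> \<int> \<and> coeff B i \<in> \<int>) \<and>
       (\<forall>i. norm (coeff A i) \<le> E ^ k \<and> norm (coeff B i) \<le> E ^ k) \<and>
       degree A \<le> 31 * k \<and> degree B \<le> 31 * k \<and> (A \<noteq> 0 \<or> B \<noteq> 0) \<and>
       [:- \<alpha>, 1:] ^ (20 * k) dvd A - smult \<alpha> B"
    using thue_auxiliary_polynomials[OF root] by blast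
  define \<rho> where "\<rho> = 2 + norm \<alpha>"
  define D where "D = 16 ^ 31 * \<rho> ^ 32 * E"
  \<comment> \<open>The constants in the estimate amount to \<open>(D*C^18)^k\<close>; the threshold
    makes this at most \<open>u^k/2\<close> as soon as \<open>Q \<le> u\<close>.\<close>
  define Q where "Q = 2 * D * C ^ 18"
  have \<rho>: "1 \<le> \<rho>" "norm \<alpha> \<le> \<rho>" by (simp_all add: \<rho>_def)
  have D1: "1 \<le> D"
  proof -
    have "1 * 1 * 1 \<le> D" unfolding D_def by (intro mult_mono one_le_power \<rho> E) (use \<rho> in auto)
    then show ?thesis by simp
  qed
  have C18: "C \<le> C ^ 18" using C by (intro self_le_power) auto
  have QC: "C \<le> Q" "2 \<le> Q"
  proof -
    have "2 * 1 * C ^ 18 \<le> Q" unfolding Q_def by (intro mult_mono) (use D1 C in auto)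
    then show "C \<le> Q" "2 \<le> Q" using C18 C by linarith+
  qed
  have "q1 \<le> q0 ^ 80" if q: "q0 > 0" "q1 > 0" "Q \<le> of_int q0"
    and h0: "norm (\<alpha> - of_int p0 / of_int q0) \<le> C / of_int q0 ^ 3"
    and h1: "norm (\<alpha> - of_int p1 / of_int q1) \<le> C / of_int q1 ^ 3" for p0 q0 p1 q1 :: int
  proof (rule ccontr)
    assume big: "\<not> q1 \<le> q0 ^ 80"
    define u v :: real where "u = of_int q0" and "v = of_int q1"
    have u: "2 \<le> u" "Q \<le> u" "C \<le> u" using q QC by (simp_all add: u_def)
    have v: "0 < v" using q by (simp add: v_def)
    have bigv: "u ^ 80 < v" using big unfolding u_def v_def by (metis not_le of_int_less_iff of_int_power)
    have "\<exists>k. v \<le> u ^ (16 * Suc k)"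
    proof -
      obtain k where "v < u ^ k" using real_arch_pow[of u v] u by auto
      also have "\<dots> \<le> u ^ (16 * Suc k)" using u by (intro power_increasing) auto
      finally show ?thesis by (intro exI[of _ k]) simp
    qed
    define k where "k = (LEAST k. v \<le> u ^ (16 * Suc k))"
    have k1: "v \<le> u ^ (16 * Suc k)" unfolding k_def by (rule LeastI_ex) fact
    \<comment> \<open>The exponent 80 is 16 * 5: for \<open>k \<le> 4\<close> the choice of
      \<open>k\<close> would give \<open>v \<le> u^80\<close>. The bound 5 is needed for
      \<open>48*k + 25 \<le> 54*k\<close> at the end.\<close>
    have k5: "5 \<le> k"
    proof (rule ccontr)
      assume "\<not> 5 \<le> k"
      then have "u ^ (16 * Suc k) \<le> u ^ 80" using u by (intro power_increasing) auto
      then show False using k1 bigv by linarith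
    qed
    have k2: "u ^ (16 * k) < v"
    proof (rule ccontr)
      assume "\<not> u ^ (16 * k) < v"
      then have "v \<le> u ^ (16 * Suc (k - 1))" using k5 by simp
      then have "k \<le> k - 1" unfolding k_def by (rule Least_le)
      then show False using k5 by simp
    qed
    define N where "N = 31 * k"
    obtain A B :: "complex poly" where AB: "\<And>i. coeff A i \<in> \<int>" "\<And>i. coeff B i \<in> \<int>"
      "\<And>i. norm (coeff A i) \<le> E ^ k" "\<And>i. norm (coeff B i) \<le> E ^ k"
      "degree A \<le> N" "degree B \<le> N" "A \<noteq> 0 \<or> B \<noteq> 0" "[:- \<alpha>, 1:] ^ (20 * k) dvd A - smult \<alpha> B"
      using aux[of k] k5 unfolding N_def by auto
    define x y :: complex where "x = of_int p0 / of_int q0" and "y = of_int p1 / of_int q1"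
    define P where "P = (\<lambda>j. coeff ((A - smult y B) \<circ>\<^sub>p [:x, 1:]) j)"
    \<comment> \<open>Vanishing to order \<open>2*k + 4\<close> at \<open>x\<close> would exceed the
      Wronskian bound \<open>2*N + 3 - 60*k = 2*k + 3\<close>.\<close>
    have "\<exists>j<2 * k + 4. P j \<noteq> 0"
    proof (rule ccontr)
      assume "\<not> ?thesis"
      then have dvd: "[:- x, 1:] ^ (2 * k + 4) dvd A - smult y B"
        unfolding linear_power_dvd_iff_coeff_shift P_def by blast
      have x': "x = of_rat (of_int p0 / of_int q0)" by (simp add: x_def of_rat_divide)
      have "(2 * k + 4) + 3 * (20 * k) \<le> 2 * N + 3"
      proof (rule thue_vanishing_order_le[OF _ noroot _ _ AB(5,6,7,8)])
        show "\<alpha>^3 + of_rat (of_int a) * \<alpha>^2 + of_rat (of_int b) * \<alpha> + of_rat (of_int c) = 0"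
          using root by simp
        show "rat_coeffs A" "rat_coeffs B" using AB(1,2) Ints_subset_Rats unfolding rat_coeffs_def by blast+
        show "N < 3 * (20 * k)" "1 \<le> 20 * k" "1 \<le> N" using k5 by (simp_all add: N_def)
        show "[:- of_rat (of_int p0 / of_int q0), 1:] ^ (2 * k + 4) dvd A - smult y B"
          using dvd unfolding x' .
      qed
      then show False by (simp add: N_def)
    qed
    then obtain j where j: "j < 2 * k + 4" "P j \<noteq> 0" by blast
    have lower: "1 \<le> u ^ N * v * norm (P j)"
    proof -
      have "of_int q0 ^ N * of_int q1 * P j \<in> \<int>"
        unfolding P_def x_def y_def by (rule coeff_shift_clear_denominators) (use AB q in auto)
      moreover have "of_int q0 ^ N * of_int q1 * P j \<noteq> 0" using j q by simp
      ultimately have "1 \<le> norm (of_int q0 ^ N * of_int q1 * P j)" by (rule Ints_norm_ge_1)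
      then show ?thesis using q by (simp add: norm_mult norm_power u_def v_def)
    qed
    define h where "h = norm (x - \<alpha>)"
    have hC: "h \<le> C / u ^ 3" using h0 by (simp add: h_def x_def u_def norm_minus_commute)
    have "u \<le> u ^ 3" using u by (intro self_le_power) auto
    then have Cu: "C / u ^ 3 \<le> 1" using u by (simp add: field_simps)
    have hh: "0 \<le> h" "h \<le> 1" using hC Cu by (simp_all add: h_def)
    have yC: "norm (\<alpha> - y) \<le> C / v ^ 3" using h1 by (simp add: y_def v_def)
    have x\<rho>: "norm x \<le> \<rho>"
      using norm_triangle_ineq[of "x - \<alpha>" \<alpha>] hh by (simp add: h_def \<rho>_def)
    have Ek: "0 \<le> E ^ k" using E by simp
    have up1: "norm (coeff ((A - smult \<alpha> B) \<circ>\<^sub>p [:x, 1:]) j) \<le> 16 ^ N * \<rho> ^ N * (E ^ k * \<rho>) * h ^ (20 * k - j)"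
      unfolding h_def
    proof (rule norm_coeff_shift_near_root_le[OF _ _ AB(8) \<rho>(2,1)])
      show "degree (A - smult \<alpha> B) \<le> N" using AB(5,6) by (simp add: degree_diff_le)
      show "norm (coeff (A - smult \<alpha> B) i) \<le> E ^ k * \<rho>" for i
      proof -
        have "norm (coeff (A - smult \<alpha> B) i) \<le> norm (coeff A i) + norm (\<alpha> * coeff B i)"
          using norm_triangle_ineq4 by simp
        also have "\<dots> \<le> E ^ k + norm \<alpha> * E ^ k"
          unfolding norm_mult by (intro add_mono mult_left_mono AB) auto
        also have "\<dots> \<le> E ^ k * \<rho>" using Ek by (simp add: \<rho>_def algebra_simps)
        finally show ?thesis .
      qed
      show "norm (x - \<alpha>) \<le> 1" using hh by (simp add: h_def)
      show "j \<le> 20 * k" using j k5 by simp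
    qed
    have up2: "norm (coeff (B \<circ>\<^sub>p [:x, 1:]) j) \<le> 4 ^ N * \<rho> ^ N * E ^ k"
      by (rule norm_coeff_shift_le[OF AB(6) AB(4) x\<rho> \<rho>(1)])
    have Dk: "16 ^ N * \<rho> ^ N * (E ^ k * \<rho>) \<le> D ^ k"
    proof -
      have "\<rho> ^ N * \<rho> = \<rho> ^ (N + 1)" by simp
      also have "\<dots> \<le> \<rho> ^ (32 * k)" using \<rho> k5 by (intro power_increasing) (auto simp: N_def)
      finally have r: "\<rho> ^ N * \<rho> \<le> \<rho> ^ (32 * k)" .
      have "16 ^ N * \<rho> ^ N * (E ^ k * \<rho>) = 16 ^ N * E ^ k * (\<rho> ^ N * \<rho>)" by (simp only: mult_ac)
      also have "\<dots> \<le> 16 ^ N * E ^ k * \<rho> ^ (32 * k)" using r Ek by (intro mult_left_mono) auto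
      also have "\<dots> = D ^ k"
        unfolding D_def N_def power_mult_distrib power_mult by (simp only: mult_ac)
      finally show ?thesis .
    qed
    \<comment> \<open>Since \<open>j \<le> 2*k + 3\<close>, at least \<open>18*k - 3\<close> orders
      of vanishing at \<alpha> remain; each contributes a factor \<open>C/u^3\<close>.\<close>
    have hj: "h ^ (20 * k - j) \<le> C ^ (18 * k) * u ^ 9 / u ^ (54 * k)"
    proof -
      have "h ^ (20 * k - j) \<le> h ^ (18 * k - 3)" using hh j by (intro power_decreasing) auto
      also have "\<dots> \<le> (C / u ^ 3) ^ (18 * k - 3)" using hh hC by (intro power_mono) auto
      also have "\<dots> = C ^ (18 * k - 3) / u ^ (54 * k - 9)"
        by (simp add: power_divide diff_mult_distrib2 flip: power_mult)
      also have "\<dots> = C ^ (18 * k - 3) * u ^ 9 / u ^ (54 * k)"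
      proof -
        have "u ^ (54 * k) = u ^ (54 * k - 9) * u ^ 9" using k5 by (simp flip: power_add)
        then show ?thesis using u by simp
      qed
      also have "\<dots> \<le> C ^ (18 * k) * u ^ 9 / u ^ (54 * k)"
        using C u by (intro divide_right_mono mult_right_mono power_increasing) auto
      finally show ?thesis .
    qed
    have "norm (P j) \<le> D ^ k * (h ^ (20 * k - j) + norm (\<alpha> - y))"
    proof -
      \<comment> \<open>Replacing \<open>y\<close> by \<alpha> separates the smallness due to the
        high vanishing at \<alpha> from that due to \<open>y\<close> being close to
        \<alpha>.\<close>
      have "P j = coeff ((A - smult \<alpha> B) \<circ>\<^sub>p [:x, 1:]) j + (\<alpha> - y) * coeff (B \<circ>\<^sub>p [:x, 1:]) j"
        unfolding P_def pcompose_diff pcompose_smult coeff_diff coeff_smult by (simp add: algebra_simps)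
      then have "norm (P j) \<le> norm (coeff ((A - smult \<alpha> B) \<circ>\<^sub>p [:x, 1:]) j)
          + norm (\<alpha> - y) * norm (coeff (B \<circ>\<^sub>p [:x, 1:]) j)"
        using norm_triangle_ineq by (metis norm_mult)
      also have "\<dots> \<le> 16 ^ N * \<rho> ^ N * (E ^ k * \<rho>) * h ^ (20 * k - j)
          + norm (\<alpha> - y) * (16 ^ N * \<rho> ^ N * (E ^ k * \<rho>))"
      proof (intro add_mono up1 mult_left_mono)
        have "(4::real) ^ N * \<rho> ^ N * E ^ k \<le> 16 ^ N * \<rho> ^ N * (E ^ k * \<rho>)"
          using \<rho> Ek mult_left_mono[OF \<rho>(1) Ek] by (intro mult_mono power_mono) auto
        then show "norm (coeff (B \<circ>\<^sub>p [:x, 1:]) j) \<le> 16 ^ N * \<rho> ^ N * (E ^ k * \<rho>)" using up2 by linarith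
      qed simp
      also have "\<dots> \<le> D ^ k * h ^ (20 * k - j) + norm (\<alpha> - y) * D ^ k"
        using Dk hh by (intro add_mono mult_left_mono mult_right_mono) auto
      finally show ?thesis by (simp add: algebra_simps)
    qed
    also have "\<dots> \<le> D ^ k * (C ^ (18 * k) * u ^ 9 / u ^ (54 * k) + C ^ (18 * k) / v ^ 3)"
    proof -
      have "C \<le> C ^ (18 * k)" using C k5 by (intro self_le_power) auto
      then have "C / v ^ 3 \<le> C ^ (18 * k) / v ^ 3" using v by (intro divide_right_mono) auto
      then show ?thesis using hj yC D1 by (intro mult_left_mono add_mono) auto
    qed
    also have "\<dots> = (D * C ^ 18) ^ k * (u ^ 9 / u ^ (54 * k) + 1 / v ^ 3)"
      by (simp add: power_mult_distrib power_mult distrib_left)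
    also have "\<dots> \<le> (u ^ k / 2) * (u ^ 9 / u ^ (54 * k) + 1 / v ^ 3)"
    proof (rule mult_right_mono)
      have DC: "0 \<le> D * C ^ 18" using D1 C by simp
      have "(2::real) \<le> 2 ^ k" using k5 self_le_power[of "2::real" k] by simp
      then have "2 * (D * C ^ 18) ^ k \<le> 2 ^ k * (D * C ^ 18) ^ k" using DC by (intro mult_right_mono) auto
      also have "\<dots> = Q ^ k" by (simp add: Q_def power_mult_distrib mult_ac)
      also have "\<dots> \<le> u ^ k" using u QC by (intro power_mono) auto
      finally show "(D * C ^ 18) ^ k \<le> u ^ k / 2" by simp
    qed (use u v in auto)
    finally have "u ^ N * v * norm (P j) \<le> u ^ N * v * ((u ^ k / 2) * (u ^ 9 / u ^ (54 * k) + 1 / v ^ 3))"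
      using u v by (intro mult_left_mono) auto
    \<comment> \<open>The sum on the right is shown to be less than 2: its first term is at most 1
      by \<open>v \<le> u^(16*(k + 1))\<close>, its second is less than 1 by
      \<open>u^(16*k) < v\<close>.\<close>
    then have "2 \<le> u ^ N * v * u ^ k * (u ^ 9 / u ^ (54 * k) + 1 / v ^ 3)"
      using lower by simp
    also have "\<dots> = (u ^ N * u ^ k * u ^ 9) * v / u ^ (54 * k) + (u ^ N * u ^ k) * (v / v ^ 3)"
      by (simp add: distrib_left mult_ac)
    also have "u ^ N * u ^ k * u ^ 9 = u ^ (32 * k + 9)" by (simp add: N_def flip: power_add)
    also have "u ^ N * u ^ k = u ^ (32 * k)" by (simp add: N_def flip: power_add)
    also have "v / v ^ 3 = 1 / v ^ 2" using v by (simp add: power2_eq_square power3_eq_cube)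
    also have "u ^ (32 * k + 9) * v / u ^ (54 * k) \<le> 1"
    proof -
      have "u ^ (32 * k + 9) * v \<le> u ^ (32 * k + 9) * u ^ (16 * Suc k)" using k1 u by (intro mult_left_mono) auto
      also have "\<dots> = u ^ (48 * k + 25)" by (simp add: add.commute flip: power_add)
      also have "\<dots> \<le> u ^ (54 * k)" using u k5 by (intro power_increasing) auto
      finally show ?thesis using u by (simp add: divide_le_eq)
    qed
    also have "u ^ (32 * k) * (1 / v ^ 2) < 1"
    proof -
      have "u ^ (32 * k) = (u ^ (16 * k)) ^ 2" by (simp flip: power_mult)
      also have "\<dots> < v ^ 2" using k2 u by (intro power_strict_mono) auto
      finally show ?thesis using v by (simp add: divide_less_eq)
    qed
    finally show False by simp
  qed
  then show thesis by (rule that)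
qed

text \<open>If some solution has denominator \<open>q0\<close> beyond the threshold
  \<open>Q\<close>, the gap bounds every denominator by \<open>q0^80\<close>; otherwise
  \<open>Q\<close> itself bounds them. For bounded \<open>q\<close> the numerators are bounded too,
  because \<open>p/q\<close> stays near \<alpha>. Nothing here is effective, since \<open>q0\<close>
  is merely assumed to exist.\<close>

theorem thue_cubic_approximation:
  fixes a b c :: int and \<alpha> :: complex and C :: real
  assumes root: "\<alpha>^3 + of_int a * \<alpha>^2 + of_int b * \<alpha> + of_int c = 0"
    and noroot: "\<And>t :: rat. t^3 + of_int a * t^2 + of_int b * t + of_int c \<noteq> 0"
  shows "finite {(p :: int, q :: int). q > 0 \<and> norm (\<alpha> - of_int p / of_int q) \<le> C / of_int q ^ 3}"
    (is "finite ?S")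
proof -
  define C' where "C' = max C 1"
  have C': "1 \<le> C'" "C \<le> C'" by (simp_all add: C'_def)
  have bd: "norm (\<alpha> - of_int p / of_int q) \<le> C' / of_int q ^ 3" if "(p, q) \<in> ?S" for p q
  proof -
    have "C / of_int q ^ 3 \<le> C' / of_int q ^ 3" using that C'(2) by (intro divide_right_mono) auto
    then show ?thesis using that by auto
  qed
  have fin: "finite ?S" if Q: "\<And>p q. (p, q) \<in> ?S \<Longrightarrow> q \<le> Q" for Q
  proof (rule finite_subset)
    define R where "R = \<lceil>of_int Q * (norm \<alpha> + C')\<rceil>"
    show "?S \<subseteq> {- R..R} \<times> {0..Q}"
    proof
      fix z assume z: "z \<in> ?S"
      then obtain p q where pq: "z = (p, q)" "(p, q) \<in> ?S" by (cases z) auto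
      have q: "0 < q" "q \<le> Q" using pq(2) Q by auto
      have q1: "1 \<le> real_of_int q" using q by simp
      have "C' / of_int q ^ 3 \<le> C' / 1" using C' q1 by (intro divide_left_mono one_le_power) auto
      then have "norm (\<alpha> - of_int p / of_int q) \<le> C'" using bd[OF pq(2)] by simp
      then have "norm (of_int p / of_int q :: complex) \<le> norm \<alpha> + C'"
        using norm_triangle_ineq4[of \<alpha> "\<alpha> - of_int p / of_int q"] by simp
      then have "\<bar>real_of_int p\<bar> \<le> of_int q * (norm \<alpha> + C')"
        using q by (simp add: norm_divide field_simps)
      also have "\<dots> \<le> of_int Q * (norm \<alpha> + C')" using q C' by (intro mult_right_mono) auto
      also have "\<dots> \<le> of_int R" unfolding R_def by (rule le_of_int_ceiling)
      finally have "\<bar>p\<bar> \<le> R" by linarith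
      then show "z \<in> {- R..R} \<times> {0..Q}" using pq q by auto
    qed
  qed simp
  obtain Q :: real where gap: "\<And>p0 q0 p1 q1 :: int. q0 > 0 \<Longrightarrow> q1 > 0 \<Longrightarrow> Q \<le> of_int q0 \<Longrightarrow>
       norm (\<alpha> - of_int p0 / of_int q0) \<le> C' / of_int q0 ^ 3 \<Longrightarrow>
       norm (\<alpha> - of_int p1 / of_int q1) \<le> C' / of_int q1 ^ 3 \<Longrightarrow> q1 \<le> q0 ^ 80"
    using thue_gap[OF root noroot C'(1)] by blast
  show ?thesis
  proof (cases "\<exists>p q. (p, q) \<in> ?S \<and> Q \<le> of_int q")
    case True
    then obtain p0 q0 where "(p0, q0) \<in> ?S" "Q \<le> of_int q0" by blast
    then have "q \<le> q0 ^ 80" if "(p, q) \<in> ?S" for p q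
      using gap[of q0 q p0 p] bd that by auto
    then show ?thesis by (rule fin)
  next
    case False
    have "q \<le> \<lceil>Q\<rceil>" if "(p, q) \<in> ?S" for p q
    proof -
      have "of_int q \<le> Q" using False that by (meson linear)
      then show ?thesis by linarith
    qed
    then show ?thesis by (rule fin)
  qed
qed

section \<open>From the Thue equation to rational approximation\<close>

lemma nearest_root_le:
  fixes u r s t :: complex
  assumes "norm (u - r) \<le> norm (u - s)" "norm (u - r) \<le> norm (u - t)"
    and "\<sigma> \<le> norm (r - s)" "\<sigma> \<le> norm (r - t)" "0 < \<sigma>"
  shows "norm (r - u) \<le> 4 / \<sigma>^2 * norm ((u - r) * (u - s) * (u - t))"
proof -
  \<comment> \<open>As \<open>r\<close> is the nearest root and at distance at least \<sigma> from
    the others, each other root is at least \<sigma>/2 away from \<open>u\<close>.\<close>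
  have s: "\<sigma>/2 \<le> norm (u - s)"
    using norm_triangle_ineq4[of "u - s" "u - r"] assms by simp
  have t: "\<sigma>/2 \<le> norm (u - t)"
    using norm_triangle_ineq4[of "u - t" "u - r"] assms by simp
  define V where "V = norm ((u - r) * (u - s) * (u - t))"
  have "norm (u - r) * (\<sigma>/2) * (\<sigma>/2) \<le> norm (u - r) * norm (u - s) * norm (u - t)"
    using s t assms(5) by (intro mult_mono) auto
  then have "norm (r - u) * (\<sigma>/2) * (\<sigma>/2) \<le> V"
    by (simp only: V_def norm_mult norm_minus_commute[of r u])
  then show ?thesis using assms(5) unfolding V_def[symmetric]
    by (simp add: field_simps power2_eq_square)
qed

text \<open>Dividing by \<open>y^3\<close> shows that the product of the distances from
  \<open>x/y\<close> to the three roots is \<open>\<bar>l\<bar>/y^3\<close>. The roots are distinct,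
  so the nearest one is approximated to order 3, and the approximation theorem applies to
  it.\<close>

theorem cubic_thue_equation_finite:
  fixes a b c l :: int
  assumes noroot: "\<And>t :: rat. t^3 + of_int a * t^2 + of_int b * t + of_int c \<noteq> 0"
  shows "finite {(x :: int, y :: int). y > 0 \<and> x^3 + a*x^2*y + b*x*y^2 + c*y^3 = l}" (is "finite ?S")
proof -
  define a' b' c' :: complex where "a' = of_int a" and "b' = of_int b" and "c' = of_int c"
  \<comment> \<open>Translation by a third of the quadratic coefficient reduces the factorisation to
    a depressed cubic.\<close>
  define e where "e = a'/3"
  have a': "a' = 3*e" by (simp add: e_def)
  obtain r0 s0 t0 where f: "r0 + s0 + t0 = 0" "r0*s0 + s0*t0 + t0*r0 = b' - 3*e^2"
    "\<And>z. z ^ 3 + (b' - 3*e^2)*z + (2*e^3 - e*b' + c') = (z - r0)*(z - s0)*(z - t0)"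
    using depressed_cubic_factors[of "b' - 3*e^2" "2*e^3 - e*b' + c'"] by metis
  define r s t where "r = r0 - e" and "s = s0 - e" and "t = t0 - e"
  have fac: "z^3 + a'*z^2 + b'*z + c' = (z - r)*(z - s)*(z - t)" for z
  proof -
    have "(z - r)*(z - s)*(z - t) = (z + e - r0)*(z + e - s0)*(z + e - t0)"
      by (simp add: r_def s_def t_def algebra_simps)
    also have "\<dots> = (z + e)^3 + (b' - 3*e^2)*(z + e) + (2*e^3 - e*b' + c')"
      by (rule f(3)[symmetric])
    also have "\<dots> = z^3 + a'*z^2 + b'*z + c'"
      unfolding a' by (simp add: algebra_simps power2_eq_square power3_eq_cube)
    finally show ?thesis by simp
  qed
  have simple: "3*z^2 + 2*a'*z + b' \<noteq> 0" if "z^3 + a'*z^2 + b'*z + c' = 0" for z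
  proof
    assume "3*z^2 + 2*a'*z + b' = 0"
    then have "of_rat (of_int b) + of_rat (2 * of_int a) * z + of_rat 3 * z^2 = 0"
      by (simp add: a'_def b'_def of_rat_mult algebra_simps)
    moreover have "z^3 + of_rat (of_int a) * z^2 + of_rat (of_int b) * z + of_rat (of_int c) = 0"
      using that by (simp add: a'_def b'_def c'_def)
    ultimately have "(3::rat) = 0" using cubic_independent[OF _ noroot] by blast
    then show False by simp
  qed
  have sum: "r + s + t = - a'" "r*s + s*t + t*r = b'"
    using f(1,2) unfolding r_def s_def t_def a' by (Groebner_Basis.algebra)+
  have roots: "z^3 + a'*z^2 + b'*z + c' = 0" if "z \<in> {r, s, t}" for z using fac[of z] that by auto
  have distinct: "r \<noteq> s" "s \<noteq> t" "t \<noteq> r"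
  proof -
    \<comment> \<open>The derivative at a root is the product of the differences to the other two,
      so simple roots are distinct.\<close>
    have "3*r^2 + 2*a'*r + b' = (r - s)*(r - t)" "3*t^2 + 2*a'*t + b' = (t - r)*(t - s)"
      using sum by Groebner_Basis.algebra+
    then show "r \<noteq> s" "s \<noteq> t" "t \<noteq> r"
      using simple[OF roots[of r]] simple[OF roots[of t]] by auto
  qed
  define \<sigma> where "\<sigma> = min (norm (r - s)) (min (norm (s - t)) (norm (t - r)))"
  have \<sigma>: "0 < \<sigma>" using distinct by (simp add: \<sigma>_def)
  define C where "C = 4 / \<sigma>^2 * \<bar>of_int l\<bar>"
  let ?T = "\<lambda>\<alpha>. {(p :: int, q :: int). q > 0 \<and> norm (\<alpha> - of_int p / of_int q) \<le> C / of_int q ^ 3}"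
  have fT: "finite (?T \<alpha>)" if "\<alpha> \<in> {r, s, t}" for \<alpha>
    using roots[OF that] unfolding a'_def b'_def c'_def by (rule thue_cubic_approximation[OF _ noroot])
  have "?S \<subseteq> ?T r \<union> ?T s \<union> ?T t"
  proof
    fix z assume "z \<in> ?S"
    then obtain x y where z: "z = (x, y)" and y: "y > 0" and e: "x^3 + a*x^2*y + b*x*y^2 + c*y^3 = l"
      by (cases z) auto
    define u :: complex where "u = of_int x / of_int y"
    have "(u - r)*(u - s)*(u - t) = u^3 + a'*u^2 + b'*u + c'" by (rule fac[symmetric])
    also have "\<dots> = of_int (x^3 + a*x^2*y + b*x*y^2 + c*y^3) / of_int y ^ 3"
      using y by (simp add: u_def a'_def b'_def c'_def field_simps power2_eq_square power3_eq_cube)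
    finally have "norm ((u - r)*(u - s)*(u - t)) = \<bar>of_int l\<bar> / of_int y ^ 3"
      unfolding e using y by (simp add: norm_divide norm_power)
    then have n: "4 / \<sigma>^2 * norm ((u - r)*(u - s)*(u - t)) = C / of_int y ^ 3" by (simp add: C_def)
    have sig: "\<sigma> \<le> norm (r - s)" "\<sigma> \<le> norm (s - r)" "\<sigma> \<le> norm (s - t)" "\<sigma> \<le> norm (t - s)"
      "\<sigma> \<le> norm (t - r)" "\<sigma> \<le> norm (r - t)"
      by (simp_all add: \<sigma>_def norm_minus_commute min_le_iff_disj)
    consider "norm (u - r) \<le> norm (u - s)" "norm (u - r) \<le> norm (u - t)"
      | "norm (u - s) \<le> norm (u - r)" "norm (u - s) \<le> norm (u - t)"
      | "norm (u - t) \<le> norm (u - r)" "norm (u - t) \<le> norm (u - s)"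
      by linarith
    then have "norm (r - u) \<le> C / of_int y ^ 3 \<or> norm (s - u) \<le> C / of_int y ^ 3 \<or> norm (t - u) \<le> C / of_int y ^ 3"
    proof cases
      case 1
      from nearest_root_le[OF this sig(1,6) \<sigma>] show ?thesis unfolding n by blast
    next
      case 2
      from nearest_root_le[OF this sig(2,3) \<sigma>] show ?thesis unfolding n[symmetric] by (simp add: mult_ac)
    next
      case 3
      from nearest_root_le[OF this sig(5,4) \<sigma>] show ?thesis unfolding n[symmetric] by (simp add: mult_ac)
    qed
    then show "z \<in> ?T r \<union> ?T s \<union> ?T t" using z y unfolding u_def by auto
  qed
  then show ?thesis by (rule finite_subset) (simp add: fT)
qed

section \<open>Finiteness of the parameters with a given splitting field\<close>

text \<open>A rational zero \<open>t\<close> gives the trace zero element \<beta> with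
  \<open>x = t\<close>, \<open>y = 1\<close> a cubic without constant term. Then \<beta> or
  \<open>\<beta>^2 + Q*P\<close> is zero; the former contradicts independence, and the latter forces
  \<open>t = - 9/2\<close> and \<open>4*m = - 27\<close>.\<close>

lemma F_form_no_rational_root:
  fixes m :: int and t :: rat
  assumes m: "m \<noteq> 0" "m \<noteq> - 8"
  shows "t^3 + of_int (- 2*m) * t^2 + of_int (- 9*m) * t + of_int (- m*(2*m + 27)) \<noteq> 0"
proof
  assume t: "t^3 + of_int (- 2*m) * t^2 + of_int (- 9*m) * t + of_int (- m*(2*m + 27)) = 0"
  define q :: rat where "q = of_int m"
  have t': "t^3 - 2*q*t^2*1 - 9*q*t*1^2 - q*(2*q + 27)*1^3 = 0"
    using t by (simp add: q_def algebra_simps)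
  obtain \<theta> where \<theta>: "\<theta>^3 + of_rat q * \<theta> + of_rat q = (0::complex)"
    using depressed_cubic_factors[of "of_rat q" "of_rat q"]
    by (metis diff_self mult_zero_left)
  have indep: "u = 0 \<and> v = 0 \<and> w = 0" if "of_rat u + of_rat v * \<theta> + of_rat w * \<theta>^2 = 0" for u v w
    using cubic_independent[of \<theta> 0 q q u v w] \<theta> that f_poly_no_rational_root[OF m] by (simp add: q_def)
  define Q T :: complex where "Q = of_rat q" and "T = of_rat t"
  define \<beta> where "\<beta> = 2*Q*1 + T*\<theta> + 3*1*\<theta>^2"
  define P where "P = T^2 + 9*T*1 - 3*Q*1^2"
  have "\<beta>^3 + Q*P*\<beta> + Q*(T^3 - 2*Q*T^2*1 - 9*Q*T*1^2 - Q*(2*Q + 27)*1^3) = 0"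
    unfolding \<beta>_def P_def by (rule trace_zero_charpoly) (use \<theta> Q_def in simp)
  moreover have "T^3 - 2*Q*T^2*1 - 9*Q*T*1^2 - Q*(2*Q + 27)*1^3
      = of_rat (t^3 - 2*q*t^2*1 - 9*q*t*1^2 - q*(2*q + 27)*1^3)"
    unfolding Q_def T_def by (simp add: of_rat_diff of_rat_add of_rat_mult of_rat_power)
  ultimately have "\<beta> * (\<beta>^2 + Q*P) = 0"
    unfolding t' by (simp add: algebra_simps power2_eq_square power3_eq_cube)
  moreover have "\<beta> \<noteq> 0"
  proof
    assume "\<beta> = 0"
    then have "of_rat (2*q) + of_rat t * \<theta> + of_rat 3 * \<theta>^2 = 0"
      unfolding \<beta>_def Q_def T_def by (simp add: of_rat_mult)
    then show False using indep by fastforce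
  qed
  ultimately have "\<beta>^2 + Q*P = 0" by simp
  moreover have "\<beta>^2 + Q*P = (Q*(4*Q - 6*T) + Q*P) + (- Q*(2*T + 9)) * \<theta> + (T^2 + 3*Q) * \<theta>^2"
    using \<theta> unfolding \<beta>_def Q_def[symmetric] by Groebner_Basis.algebra
  ultimately have "of_rat (q*(4*q - 6*t) + q*(t^2 + 9*t - 3*q)) + of_rat (- q*(2*t + 9)) * \<theta>
      + of_rat (t^2 + 3*q) * \<theta>^2 = 0"
    unfolding P_def Q_def T_def of_rat_diff of_rat_add of_rat_mult of_rat_power of_rat_minus by simp
  then have e: "- q*(2*t + 9) = 0" "t^2 + 3*q = 0" using indep by blast+
  have "q \<noteq> 0" using m by (simp add: q_def)
  then have "t = - 9/2" using e(1) by simp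
  then have "of_int (4*m) = (of_int (- 27) :: rat)" using e(2) by (simp add: q_def power2_eq_square)
  then have "4*m = - 27" by (simp only: of_int_eq_iff)
  then show False by presburger
qed

lemma finite_square_divisors:
  fixes d :: int
  assumes "d \<noteq> 0"
  shows "finite {l. l^2 dvd d}"
proof (rule finite_subset)
  show "{l. l^2 dvd d} \<subseteq> {- \<bar>d\<bar>..\<bar>d\<bar>}"
  proof
    fix l assume "l \<in> {l. l^2 dvd d}"
    then have "l dvd d" by (metis dvd_mult_left mem_Collect_eq power2_eq_square)
    then have "\<bar>l\<bar> \<le> \<bar>d\<bar>" using assms by (simp add: dvd_imp_le_int)
    then show "l \<in> {- \<bar>d\<bar>..\<bar>d\<bar>}" by auto
  qed
qed simp

text \<open>Every \<open>n\<close> other than 0 and \<open>m\<close> is the parameter of a pair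
  \<open>(x, y)\<close> whose form value has square dividing a fixed nonzero integer. There are
  finitely many such values, and Thue's theorem leaves finitely many pairs for each.\<close>

lemma finite_same_splitting_field:
  fixes m :: int
  assumes m: "m \<noteq> 0"
  shows "finite {n::int. splitting_field (f_poly (of_int m)) = splitting_field (f_poly (of_int n))}"
proof -
  define T where "T = m^3*(4*m + 27)^5"
  have "4*m + 27 \<noteq> 0" by presburger
  then have T: "T \<noteq> 0" using m by (simp add: T_def)
  define S where "S = (\<lambda>l. {(x::int, y::int). y > 0 \<and> F_form m x y = l})"
  have S: "finite (S l)" if "m \<noteq> - 8" for l
  proof -
    have "S l = {(x, y). y > 0 \<and> x^3 + (- 2*m)*x^2*y + (- 9*m)*x*y^2 + (- m*(2*m + 27))*y^3 = l}"
      by (simp add: S_def F_form_def)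
    then show ?thesis
      using cubic_thue_equation_finite[OF F_form_no_rational_root[OF m that]] by simp
  qed
  define U where "U = (\<lambda>(x, y). \<lfloor>n_param m x y\<rfloor>) ` (\<Union>l\<in>{l. l^2 dvd T}. if m = - 8 then {} else S l)"
  have "finite U" unfolding U_def using S finite_square_divisors[OF T] by auto
  moreover have "{n::int. splitting_field (f_poly (of_int m)) = splitting_field (f_poly (of_int n))} \<subseteq> {0, m} \<union> U"
  proof
    fix n assume "n \<in> {n::int. splitting_field (f_poly (of_int m)) = splitting_field (f_poly (of_int n))}"
    then have eq: "splitting_field (f_poly (of_int n)) = splitting_field (f_poly (of_int m))" by simp
    show "n \<in> {0, m} \<union> U"
    proof (cases "n = 0 \<or> n = m")
      case False
      then obtain x y where xy: "m \<noteq> - 8" "y > 0" "(F_form m x y)^2 dvd T" "of_int n = n_param m x y"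
        using splitting_field_eq_imp_n_param[OF m _ _ eq] unfolding T_def by metis
      have "n = (\<lambda>(x, y). \<lfloor>n_param m x y\<rfloor>) (x, y)" by (simp add: xy(4)[symmetric])
      moreover have "(x, y) \<in> (\<Union>l\<in>{l. l^2 dvd T}. if m = - 8 then {} else S l)"
        using xy by (auto simp: S_def)
      ultimately have "n \<in> U" unfolding U_def by (rule image_eqI)
      then show ?thesis by blast
    qed auto
  qed
  ultimately show ?thesis by (meson finite.simps finite_UnI finite_subset)
qed

theorem theorem2:
  fixes m :: int
  assumes "m \<noteq> 0"
  shows
    "(\<forall>n::int. n \<noteq> 0 \<longrightarrow> n \<noteq> m \<longrightarrow>
        splitting_field (f_poly (of_int n)) = splitting_field (f_poly (of_int m)) \<longrightarrow>
        (\<exists>l x y :: int. l^2 dvd m^3 * (4*m + 27)^5 \<and> coprime x y \<and> y > 0 \<and>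
           F_form m x y = l \<and> of_int n = n_param m x y))
     \<and> (\<forall>l x y :: int. l^2 dvd m^3 * (4*m + 27)^5 \<longrightarrow> coprime x y \<longrightarrow> F_form m x y = l \<longrightarrow>
          (\<forall>n::rat. n = n_param m x y \<longrightarrow> n \<noteq> 0 \<longrightarrow> n \<noteq> - 27 / 4 \<longrightarrow>
             splitting_field (f_poly n) = splitting_field (f_poly (of_int m))))
     \<and> finite {n::int. splitting_field (f_poly (of_int m)) = splitting_field (f_poly (of_int n))}"
proof (intro conjI allI impI)
  fix n :: int
  assume "n \<noteq> 0" "n \<noteq> m" "splitting_field (f_poly (of_int n)) = splitting_field (f_poly (of_int m))"
  then obtain x y where "coprime x y" "y > 0" "(F_form m x y)^2 dvd m^3*(4*m + 27)^5"
    "of_int n = n_param m x y"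
    using splitting_field_eq_imp_n_param[OF assms] by metis
  then show "\<exists>l x y :: int. l^2 dvd m^3 * (4*m + 27)^5 \<and> coprime x y \<and> y > 0 \<and>
           F_form m x y = l \<and> of_int n = n_param m x y" by blast
next
  fix l x y :: int and n :: rat
  assume l: "l^2 dvd m^3 * (4*m + 27)^5" "F_form m x y = l"
    and n: "n = n_param m x y" "n \<noteq> 0" "n \<noteq> - 27 / 4"
  \<comment> \<open>An odd number is nonzero, so the divisor condition excludes \<open>l = 0\<close>
    and the denominator of the parametrisation does not vanish.\<close>
  have "4*m + 27 \<noteq> 0" by presburger
  then have "l \<noteq> 0" using l(1) assms by auto
  then show "splitting_field (f_poly n) = splitting_field (f_poly (of_int m))"
    using splitting_field_n_param[OF assms _ n] l(2) by blast
next
  show "finite {n::int. splitting_field (f_poly (of_int m)) = splitting_field (f_poly (of_int n))}"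
    by (rule finite_same_splitting_field[OF assms])
qed

end
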